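(* Let $(X,\rho)$ be a proper, unbounded, cocompact metric space which is $M$-connected for some $M>0$, and suppose that the asymptotic power dimension $\mathrm{asdim}_P X$ is finite. Then $$\mathrm{asdim}_P X=\dim \nu_P X,$$ where $\nu_P X$ is the subpower corona of $X$.
   Context: A metric space is proper if every closed ball in it is compact. A metric space $(X,\rho)$ is cocompact if there is a compact subset $K\subset X$ with $X=\bigcup\{f(K)\mid f\in \mathrm{Isom}(X)\}$, where $\mathrm{Isom}(X)$ is the set of all isometries of $X$. For $M>0$, $(X,\rho)$ is $M$-connected if for all $x,y\in X$ there are points $x=x_0,x_1,\dots,x_k=y$ of $X$ with $\rho(x_i,x_{i+1})\le M$ for every $i=0,\dots,k-1$. For $D>0$, a family $\mathcal{U}$ of subsets of $X$ is $D$-bounded if $\mathrm{diam}(U)\le D$ for every $U\in\mathcal{U}$; it is $D$-disjoint if $\inf\{\rho(x,y)\mid x\in U,\ y\in V\}>D$ for all $U,V\in\mathcal{U}$ with $U\ne V$. For an integer $n\ge 0$, $\mathrm{asdim}_P X\le n$ (asymptotic power dimension) means: there are constants $\alpha>0$ and $r_0>0$ such that for every $r>r_0$ there exist $r$-disjoint and $r^\alpha$-bounded families $\mathcal{U}_0,\dots,\mathcal{U}_n$ of subsets of $X$ such that $\bigcup_{i=0}^n\mathcal{U}_i$ is a cover of $X$. $\mathrm{asdim}_P X$ is the least such $n$ (it is finite if such an $n$ exists). A function $p:\mathbb{R}_+\to\mathbb{R}_+$ is asymptotically subpower if for every $\alpha>0$ there is $r_0>0$ such that $p(t)<t^\alpha$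 for all $t>r_0$. Let $(X,\rho)$ be an unbounded proper metric space with basepoint $x_0$, write $|x|=\rho(x,x_0)$, and let $B_r(x)=\{y\in X\mid\rho(x,y)<r\}$. A bounded continuous function $f:X\to\mathbb{R}$ is Higson subpower if for every asymptotically subpower function $p$ one has $\lim_{|x|\to\infty}\mathrm{diam}\big(f(B_{p(|x|)}(x))\big)=0$ (with $\mathrm{diam}\,\emptyset=0$). The Higson subpower functions form a subalgebra $CB_P(X)$ of the algebra of bounded continuous real functions on $X$. $h_P X$ denotes the compactification of $X$ with respect to $CB_P(X)$ (the compactification such that the bounded continuous functions on $X$ that extend continuously to it are exactly the elements of $CB_P(X)$), and the subpower corona is $\nu_P X=h_P X\setminus X$. $\dim$ denotes covering dimension. *)

theory Defs
  imports "HOL-Analysis.Analysis"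
begin

text \<open>
  A metric space is a subset \<open>X\<close> of a type of class \<^class>\<open>metric_space\<close>, with the
  restricted distance; all notions below are relative to \<open>X\<close>.
\<close>

definition proper_space :: "'a::metric_space set \<Rightarrow> bool" where
  "proper_space X \<longleftrightarrow> (\<forall>x\<in>X. \<forall>r. compact (cball x r \<inter> X))"

definition isometries :: "'a::metric_space set \<Rightarrow> ('a \<Rightarrow> 'a) set" where
  "isometries X = {f. f ` X = X \<and> (\<forall>x\<in>X. \<forall>y\<in>X. dist (f x) (f y) = dist x y)}"

definition cocompact_space :: "'a::metric_space set \<Rightarrow> bool" where
  "cocompact_space X \<longleftrightarrow> (\<exists>K. K \<subseteq> X \<and> compact K \<and> X = (\<Union>f\<in>isometries X. f ` K))"

definition M_connected :: "real \<Rightarrow> 'a::metric_space set \<Rightarrow> bool" where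
  "M_connected M X \<longleftrightarrow>
     (\<forall>x\<in>X. \<forall>y\<in>X. \<exists>(k::nat) z. z 0 = x \<and> z k = y \<and> (\<forall>i\<le>k. z i \<in> X) \<and>
        (\<forall>i<k. dist (z i) (z (Suc i)) \<le> M))"


subsection \<open>Asymptotic power dimension\<close>

text \<open>The real-valued \<^const>\<open>diameter\<close> is meaningful only for bounded sets.\<close>

definition D_bounded :: "real \<Rightarrow> 'a::metric_space set set \<Rightarrow> bool" where
  "D_bounded D \<U> \<longleftrightarrow> (\<forall>U\<in>\<U>. bounded U \<and> diameter U \<le> D)"

text \<open>
  The infimum is taken in \<^typ>\<open>ereal\<close>, so that it is \<open>\<infinity>\<close> when \<open>U\<close> or \<open>V\<close> is empty
  (whereas \<^const>\<open>setdist\<close> is \<open>0\<close> in that case).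
\<close>

definition D_disjoint :: "real \<Rightarrow> 'a::metric_space set set \<Rightarrow> bool" where
  "D_disjoint D \<U> \<longleftrightarrow>
     (\<forall>U\<in>\<U>. \<forall>V\<in>\<U>. U \<noteq> V \<longrightarrow> (INF (x,y)\<in>U \<times> V. ereal (dist x y)) > ereal D)"

definition asdimP_le :: "'a::metric_space set \<Rightarrow> nat \<Rightarrow> bool" where
  "asdimP_le X n \<longleftrightarrow>
     (\<exists>\<alpha>>0. \<exists>r0>0. \<forall>r>r0. \<exists>\<U> :: nat \<Rightarrow> 'a set set.
        (\<forall>i\<le>n. \<U> i \<subseteq> Pow X \<and> D_disjoint r (\<U> i) \<and> D_bounded (r powr \<alpha>) (\<U> i)) \<and>
        \<Union> (\<Union>i\<le>n. \<U> i) = X)"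

text \<open>The least such \<open>n\<close>, and \<open>\<infinity>\<close> (the infimum of the empty set) if there is none.\<close>

definition asdimP :: "'a::metric_space set \<Rightarrow> ereal" where
  "asdimP X = Inf {ereal (real n) | n. asdimP_le X n}"


subsection \<open>Covering dimension\<close>

text \<open>
  As for the small inductive dimension \<^const>\<open>dimension_le\<close>, the bound is an integer
  \<open>n \<ge> -1\<close>; exactly the empty space has dimension \<open>-1\<close>.
\<close>

definition covering_dim_le :: "'a topology \<Rightarrow> int \<Rightarrow> bool" where
  "covering_dim_le T n \<longleftrightarrow> -1 \<le> n \<and>
     (\<forall>\<U>. finite \<U> \<and> (\<forall>U\<in>\<U>. openin T U) \<and> \<Union>\<U> = topspace T \<longrightarrow>
        (\<exists>\<V>. finite \<V> \<and> (\<forall>V\<in>\<V>. openin T V) \<and> \<Union>\<V> = topspace T \<and>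
             (\<forall>V\<in>\<V>. \<exists>U\<in>\<U>. V \<subseteq> U) \<and>
             (\<forall>x\<in>topspace T. int (card {V\<in>\<V>. x \<in> V}) \<le> n + 1)))"

definition covering_dim :: "'a topology \<Rightarrow> ereal" where
  "covering_dim T = Inf {ereal (real_of_int n) | n. covering_dim_le T n}"


subsection \<open>Higson subpower functions and the subpower corona\<close>

definition asymptotically_subpower :: "(real \<Rightarrow> real) \<Rightarrow> bool" where
  "asymptotically_subpower p \<longleftrightarrow>
     p \<in> {0..} \<rightarrow> {0..} \<and> (\<forall>\<alpha>>0. \<exists>r0>0. \<forall>t>r0. p t < t powr \<alpha>)"

text \<open>The filter expresses \<open>|x| \<rightarrow> \<infinity>\<close> for \<open>x\<close> ranging over \<open>X\<close>, where \<open>|x| = dist x x0\<close>.\<close>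

definition higson_subpower :: "'a::metric_space set \<Rightarrow> 'a \<Rightarrow> ('a \<Rightarrow> real) \<Rightarrow> bool" where
  "higson_subpower X x0 f \<longleftrightarrow> continuous_on X f \<and> bounded (f ` X) \<and>
     (\<forall>p. asymptotically_subpower p \<longrightarrow>
        ((\<lambda>x. diameter (f ` (ball x (p (dist x x0)) \<inter> X))) \<longlongrightarrow> 0)
          (inf (filtercomap (\<lambda>x. dist x x0) at_top) (principal X)))"

definition compactification :: "'a topology \<Rightarrow> 'b topology \<Rightarrow> ('a \<Rightarrow> 'b) \<Rightarrow> bool" where
  "compactification T H \<iota> \<longleftrightarrow> compact_space H \<and> Hausdorff_space H \<and>
     embedding_map T H \<iota> \<and> H closure_of (\<iota> ` topspace T) = topspace H"

text \<open>
  \<open>(H, \<iota>)\<close> is a representative of \<open>h\<^sub>P X\<close>, which is determined only up to homeomorphism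
  under \<open>X\<close>.
\<close>

definition subpower_compactification ::
    "'a::metric_space set \<Rightarrow> 'a \<Rightarrow> 'b topology \<Rightarrow> ('a \<Rightarrow> 'b) \<Rightarrow> bool" where
  "subpower_compactification X x0 H \<iota> \<longleftrightarrow> compactification (top_of_set X) H \<iota> \<and>
     (\<forall>f. continuous_on X f \<and> bounded (f ` X) \<longrightarrow>
        ((\<exists>g. continuous_map H euclideanreal g \<and> (\<forall>x\<in>X. g (\<iota> x) = f x)) \<longleftrightarrow>
         higson_subpower X x0 f))"

definition corona :: "'a set \<Rightarrow> 'b topology \<Rightarrow> ('a \<Rightarrow> 'b) \<Rightarrow> 'b topology" where
  "corona X H \<iota> = subtopology H (topspace H - \<iota> ` X)"


subsection \<open>Existence of the subpower compactification\<close>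

lemma higson_subpower_iff:
  "higson_subpower X x0 f \<longleftrightarrow> continuous_on X f \<and> bounded (f ` X) \<and>
     (\<forall>p. asymptotically_subpower p \<longrightarrow> (\<forall>e>0. \<exists>R. \<forall>x\<in>X. dist x x0 > R \<longrightarrow>
        (\<forall>y\<in>X. \<forall>z\<in>X. dist x y < p (dist x x0) \<longrightarrow> dist x z < p (dist x x0) \<longrightarrow> \<bar>f y - f z\<bar> \<le> e)))"
proof -
  have "((\<lambda>x. diameter (f ` (ball x (p (dist x x0)) \<inter> X))) \<longlongrightarrow> 0)
          (inf (filtercomap (\<lambda>x. dist x x0) at_top) (principal X)) \<longleftrightarrow>
        (\<forall>e>0. \<exists>R. \<forall>x\<in>X. dist x x0 > R \<longrightarrow>
        (\<forall>y\<in>X. \<forall>z\<in>X. dist x y < p (dist x x0) \<longrightarrow> dist x z < p (dist x x0) \<longrightarrow> \<bar>f y - f z\<bar> \<le> e))"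
    (is "?L \<longleftrightarrow> ?R") if b: "bounded (f ` X)" for p
  proof -
    let ?B = "\<lambda>x. f ` (ball x (p (dist x x0)) \<inter> X)"
    have bB: "bounded (?B x)" for x
      by (rule bounded_subset[OF b]) auto
    have L: "?L \<longleftrightarrow> (\<forall>e>0. \<exists>R. \<forall>x\<in>X. dist x x0 > R \<longrightarrow> diameter (?B x) < e)"
      unfolding tendsto_iff eventually_inf_principal eventually_filtercomap_at_top_dense
      using diameter_ge_0[OF bB] by (simp add: Ball_def) blast
    show ?thesis
    proof
      assume ?L
      show ?R
      proof (intro allI impI)
        fix e :: real assume "e > 0"
        with \<open>?L\<close> obtain R where R: "\<forall>x\<in>X. dist x x0 > R \<longrightarrow> diameter (?B x) < e"
          unfolding L by blast
        show "\<exists>R. \<forall>x\<in>X. dist x x0 > R \<longrightarrow> (\<forall>y\<in>X. \<forall>z\<in>X. dist x y < p (dist x x0) \<longrightarrow>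
          dist x z < p (dist x x0) \<longrightarrow> \<bar>f y - f z\<bar> \<le> e)"
        proof (intro exI[of _ R] ballI impI)
          fix x y z
          assume *: "x \<in> X" "dist x x0 > R" "y \<in> X" "z \<in> X" "dist x y < p (dist x x0)" "dist x z < p (dist x x0)"
          have "dist (f y) (f z) \<le> diameter (?B x)"
            by (rule diameter_bounded_bound[OF bB]) (use * in auto)
          then show "\<bar>f y - f z\<bar> \<le> e"
            using R * by (fastforce simp: dist_real_def)
        qed
      qed
    next
      assume R: ?R
      show ?L unfolding L
      proof (intro allI impI)
        fix e :: real assume "e > 0"
        with R obtain R where R: "\<forall>x\<in>X. dist x x0 > R \<longrightarrow> (\<forall>y\<in>X. \<forall>z\<in>X. dist x y < p (dist x x0) \<longrightarrow>
          dist x z < p (dist x x0) \<longrightarrow> \<bar>f y - f z\<bar> \<le> e/2)"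
          by (meson half_gt_zero)
        show "\<exists>R. \<forall>x\<in>X. dist x x0 > R \<longrightarrow> diameter (?B x) < e"
        proof (intro exI[of _ R] ballI impI)
          fix x assume "x \<in> X" "dist x x0 > R"
          then have "diameter (?B x) \<le> e/2"
            using R \<open>e > 0\<close> by (intro diameter_le) auto
          then show "diameter (?B x) < e" using \<open>e > 0\<close> by simp
        qed
      qed
    qed
  qed
  then show ?thesis unfolding higson_subpower_def by blast
qed

lemma higson_subpowerE:
  assumes "higson_subpower X x0 f" "asymptotically_subpower p" "e > 0"
  obtains R where "\<forall>x\<in>X. dist x x0 > R \<longrightarrow>
    (\<forall>y\<in>X. \<forall>z\<in>X. dist x y < p (dist x x0) \<longrightarrow> dist x z < p (dist x x0) \<longrightarrow> \<bar>f y - f z\<bar> \<le> e)"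
  using assms(1)[unfolded higson_subpower_iff] assms(2,3) by blast

lemma higson_subpower_const: "higson_subpower X x0 (\<lambda>_. c)"
  unfolding higson_subpower_iff by (simp add: image_constant_conv)

lemma higson_subpower_bump:
  assumes "r > 0"
  shows "higson_subpower X x0 (\<lambda>x. max 0 (r - dist a x))"
  unfolding higson_subpower_iff
proof (intro conjI allI impI)
  show "continuous_on X (\<lambda>x. max 0 (r - dist a x))"
    by (intro continuous_intros)
  show "bounded ((\<lambda>x. max 0 (r - dist a x)) ` X)"
    unfolding bounded_iff using assms by (intro exI[of _ r]) auto
  fix p and e :: real
  assume p: "asymptotically_subpower p" and "e > 0"
  then obtain r0 where r0: "\<And>t. t > r0 \<Longrightarrow> p t < t powr (1/2)"
    unfolding asymptotically_subpower_def by (meson half_gt_zero_iff zero_less_one)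
  define C where "C = dist a x0 + r"
  have far: "max 0 (r - dist a y) = 0"
    if x: "dist x x0 > max r0 (max 4 (2*C))" and y: "dist x y < p (dist x x0)" for x y
  proof -
    let ?t = "dist x x0"
    have "sqrt ?t * 2 \<le> sqrt ?t * sqrt ?t"
      using x by (intro mult_left_mono real_le_rsqrt) auto
    then have "sqrt ?t \<le> ?t / 2" by simp
    moreover have "p ?t < sqrt ?t"
      using r0[of ?t] x by (simp add: powr_half_sqrt)
    moreover have "?t \<le> dist x y + dist a y + dist a x0"
      using dist_triangle[of x x0 y] dist_triangle[of y x0 a] by (simp add: dist_commute)
    ultimately show ?thesis using x y by (simp add: C_def)
  qed
  show "\<exists>R. \<forall>x\<in>X. dist x x0 > R \<longrightarrow> (\<forall>y\<in>X. \<forall>z\<in>X. dist x y < p (dist x x0) \<longrightarrow>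
      dist x z < p (dist x x0) \<longrightarrow> \<bar>max 0 (r - dist a y) - max 0 (r - dist a z)\<bar> \<le> e)"
    by (rule exI[of _ "max r0 (max 4 (2*C))"]) (use far \<open>e > 0\<close> in fastforce)
qed

lemma compact_uniform_coordinates:
  fixes g :: "('i \<Rightarrow> real) \<Rightarrow> real"
  assumes K: "compact K" and g: "continuous_on K g" and "e > 0"
  obtains I d where "finite I" "d > 0"
    "\<And>u v. u \<in> K \<Longrightarrow> v \<in> K \<Longrightarrow> (\<forall>i\<in>I. \<bar>u i - v i\<bar> < d) \<Longrightarrow> \<bar>g u - g v\<bar> < e"
proof -
  have "\<exists>I d. finite I \<and> d > 0 \<and> (\<forall>v\<in>K. (\<forall>i\<in>I. \<bar>u i - v i\<bar> < 2 * d) \<longrightarrow> \<bar>g u - g v\<bar> < e/2)"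
    if u: "u \<in> K" for u
  proof -
    obtain A where A: "open A" "A \<inter> K = g -` ball (g u) (e/2) \<inter> K"
      using g unfolding continuous_on_open_invariant by (meson open_ball)
    have "u \<in> A" using A(2) u \<open>e > 0\<close> by auto
    then obtain W where W: "u \<in> Pi\<^sub>E UNIV W" "\<And>i. open (W i)" "finite {i. W i \<noteq> UNIV}"
        "Pi\<^sub>E UNIV W \<subseteq> A"
      using product_topology_open_contains_basis[of "\<lambda>_. euclidean" UNIV A u] A(1)
      by (auto simp: euclidean_product_topology)
    define I where "I = {i. W i \<noteq> UNIV}"
    have "\<exists>r>0. ball (u i) r \<subseteq> W i" for i
      using W(1,2) open_contains_ball by (metis PiE_mem UNIV_I)
    then obtain r where r: "\<And>i. r i > 0" "\<And>i. ball (u i) (r i) \<subseteq> W i" by metis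
    define d where "d = Min (insert 1 (r ` I)) / 2"
    have "d > 0" "\<And>i. i \<in> I \<Longrightarrow> 2 * d \<le> r i"
      using W(3) r(1) by (auto simp: d_def I_def)
    moreover have "\<bar>g u - g v\<bar> < e/2" if "v \<in> K" "\<forall>i\<in>I. \<bar>u i - v i\<bar> < 2 * d" for v
    proof -
      have "v i \<in> W i" for i
      proof (cases "i \<in> I")
        case True
        then have "v i \<in> ball (u i) (r i)"
          using that(2) \<open>\<And>i. i \<in> I \<Longrightarrow> 2 * d \<le> r i\<close>[OF True] by (auto simp: dist_real_def)
        then show ?thesis using r(2) by blast
      qed (simp add: I_def)
      then have "v \<in> A" using W(4) by auto
      then show ?thesis using A(2) that(1) by (auto simp: dist_real_def)
    qed
    ultimately show ?thesis using W(3) unfolding I_def by blast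
  qed
  then obtain I d where Id: "\<And>u. u \<in> K \<Longrightarrow> finite (I u)" "\<And>u. u \<in> K \<Longrightarrow> d u > 0"
    "\<And>u v. u \<in> K \<Longrightarrow> v \<in> K \<Longrightarrow> (\<forall>i\<in>I u. \<bar>u i - v i\<bar> < 2 * d u) \<Longrightarrow> \<bar>g u - g v\<bar> < e/2"
    by metis
  define N where "N u = (\<Inter>i\<in>I u. {v. \<bar>u i - v i\<bar> < d u})" for u
  have "open (N u)" if "u \<in> K" for u
    unfolding N_def using Id(1)[OF that]
    by (intro open_INT ballI open_Collect_less continuous_intros continuous_on_product_coordinates)
  moreover have "K \<subseteq> (\<Union>u\<in>K. N u)" using Id(2) by (force simp: N_def)
  ultimately obtain F where F: "F \<subseteq> K" "finite F" "K \<subseteq> (\<Union>u\<in>F. N u)"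
    by (rule compactE_image[OF K])
  define D where "D = Min (insert 1 (d ` F))"
  have D: "D > 0" "\<And>u. u \<in> F \<Longrightarrow> D \<le> d u"
    using F(1,2) Id(2) by (auto simp: D_def)
  have "\<bar>g u - g v\<bar> < e"
    if uv: "u \<in> K" "v \<in> K" "\<forall>i\<in>(\<Union>w\<in>F. I w). \<bar>u i - v i\<bar> < D" for u v
  proof -
    obtain w where w: "w \<in> F" "u \<in> N w" using F(3) uv(1) by blast
    have 1: "\<bar>w i - u i\<bar> < d w" if "i \<in> I w" for i using w(2) that by (auto simp: N_def)
    have 2: "\<bar>u i - v i\<bar> < d w" if "i \<in> I w" for i using uv(3) D(2)[OF w(1)] w(1) that by fastforce
    have "\<bar>g w - g u\<bar> < e/2" "\<bar>g w - g v\<bar> < e/2"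
      using Id(3)[of w u] Id(3)[of w v] F(1) w(1) uv 1 2 by fastforce+
    then show ?thesis by linarith
  qed
  with F Id(1) D(1) show ?thesis by (intro that[of "\<Union>w\<in>F. I w" D]) auto
qed

text \<open>
  The compactification is the closure of the image of \<open>X\<close> under evaluation. Properness of \<open>X\<close> is
  not needed here: it only makes \<open>X\<close> open in the compactification.
\<close>

theorem subpower_compactification_exists:
  fixes X :: "'a::metric_space set"
  obtains H :: "(('a \<Rightarrow> real) \<Rightarrow> real) topology" and \<iota>
  where "subpower_compactification X x0 H \<iota>"
proof -
  define e :: "'a \<Rightarrow> ('a \<Rightarrow> real) \<Rightarrow> real" where "e x f = (if higson_subpower X x0 f then f x else 0)" for x f
  define K where "K = closure (e ` X)"
  have e_sub: "e ` X \<subseteq> K" unfolding K_def by (rule closure_subset)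
  have HSe: "higson_subpower X x0 (\<lambda>x. e x f)" for f
    by (cases "higson_subpower X x0 f") (simp_all add: e_def higson_subpower_const)
  have "\<exists>B. \<forall>x\<in>X. \<bar>e x f\<bar> \<le> B" for f
    using HSe[of f] unfolding higson_subpower_def bounded_iff by auto
  then obtain B where B: "\<And>x f. x \<in> X \<Longrightarrow> \<bar>e x f\<bar> \<le> B f" by metis
  have cP: "compact (Pi\<^sub>E UNIV (\<lambda>f. {- B f..B f}))"
    unfolding compactin_euclidean_iff[symmetric] euclidean_product_topology[symmetric] compactin_PiE
    by simp
  have "e ` X \<subseteq> Pi\<^sub>E UNIV (\<lambda>f. {- B f..B f})"
    using B by (force simp: abs_le_iff)
  moreover have "closed (Pi\<^sub>E UNIV (\<lambda>f. {- B f..B f}))"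
    unfolding closed_closedin euclidean_product_topology[symmetric] closedin_product_topology
    by simp
  ultimately have "K \<subseteq> Pi\<^sub>E UNIV (\<lambda>f. {- B f..B f})"
    unfolding K_def by (rule closure_minimal)
  then have K: "compact K"
    using compact_Int_closed[OF cP, of K] by (simp add: K_def Int_absorb1)
  have "Hausdorff_space (euclidean :: (('a \<Rightarrow> real) \<Rightarrow> real) topology)"
    unfolding euclidean_product_topology[symmetric] Hausdorff_space_product_topology by simp
  then have hK: "Hausdorff_space (top_of_set K)"
    by (rule Hausdorff_space_subtopology)
  have ce: "continuous_on X e"
    using HSe by (intro continuous_on_coordinatewise_then_product) (auto simp: higson_subpower_def)
  have bump: "e x (\<lambda>x. max 0 (r - dist a x)) = max 0 (r - dist a x)" if "r > 0" for r a x
    using higson_subpower_bump[OF that, of X x0 a] by (simp add: e_def)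
  have inj: "inj_on e X"
  proof (rule inj_onI, rule ccontr)
    fix a b assume "e a = e b" "a \<noteq> b"
    then show False
      using bump[of "dist a b" a a] bump[of "dist a b" b a] by simp
  qed
  have op: "openin (top_of_set (e ` X)) (e ` U)" if U: "openin (top_of_set X) U" for U
  proof (subst openin_subopen, intro ballI)
    fix u assume "u \<in> e ` U"
    then obtain a where a: "a \<in> U" "u = e a" by blast
    obtain r where r: "r > 0" "ball a r \<inter> X \<subseteq> U"
      using U a(1) unfolding openin_contains_ball by blast
    let ?f = "\<lambda>x. max 0 (r - dist a x)"
    have "open {v :: ('a \<Rightarrow> real) \<Rightarrow> real. 0 < v ?f}"
      by (intro open_Collect_less continuous_intros continuous_on_product_coordinates)
    then have "openin (top_of_set (e ` X)) (e ` X \<inter> {v. 0 < v ?f})"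
      by (rule openin_open_Int)
    moreover have "u \<in> e ` X \<inter> {v. 0 < v ?f}"
      using a r U bump[OF r(1), of a a] openin_imp_subset by fastforce
    moreover have "e ` X \<inter> {v. 0 < v ?f} \<subseteq> e ` U"
      using r bump[OF r(1)] by (auto simp: less_max_iff_disj intro!: imageI)
    ultimately show "\<exists>T. openin (top_of_set (e ` X)) T \<and> u \<in> T \<and> T \<subseteq> e ` U"
      by blast
  qed
  obtain g where "homeomorphism X (e ` X) e g"
    by (rule homeomorphism_injective_open_map[OF ce refl inj op])
  then have "homeomorphic_map (top_of_set X) (top_of_set (e ` X)) e"
    by (auto simp: homeomorphic_map_maps homeomorphic_maps_def homeomorphism_def)
  then have "embedding_map (top_of_set X) (top_of_set K) e"
    using e_sub by (simp add: embedding_map_def subtopology_subtopology Int_absorb1)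
  moreover have "(top_of_set K) closure_of (e ` X) = K"
    using e_sub by (simp add: closure_of_subtopology Int_absorb1 K_def)
  ultimately have comp: "compactification (top_of_set X) (top_of_set K) e"
    using K hK by (simp add: compactification_def compact_space_subtopology)
  have ext: "\<exists>g. continuous_map (top_of_set K) euclideanreal g \<and> (\<forall>x\<in>X. g (e x) = f x)"
    if "higson_subpower X x0 f" for f
    using that
    by (intro exI[of _ "\<lambda>u. u f"])
       (auto simp: e_def intro: continuous_on_subset[OF continuous_on_product_coordinates])
  have res: "higson_subpower X x0 f"
    if f: "continuous_on X f" "bounded (f ` X)"
      and g: "continuous_on K g" "\<And>x. x \<in> X \<Longrightarrow> g (e x) = f x" for f g
    unfolding higson_subpower_iff
  proof (intro conjI f allI impI)
    fix p and \<epsilon> :: real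
    assume p: "asymptotically_subpower p" and "\<epsilon> > 0"
    obtain I d where I: "finite I" "d > 0"
      "\<And>u v. u \<in> K \<Longrightarrow> v \<in> K \<Longrightarrow> (\<forall>i\<in>I. \<bar>u i - v i\<bar> < d) \<Longrightarrow> \<bar>g u - g v\<bar> < \<epsilon>"
      by (rule compact_uniform_coordinates[OF K g(1) \<open>\<epsilon> > 0\<close>]) blast
    have "\<exists>R. \<forall>x\<in>X. dist x x0 > R \<longrightarrow> (\<forall>y\<in>X. \<forall>z\<in>X. dist x y < p (dist x x0) \<longrightarrow>
        dist x z < p (dist x x0) \<longrightarrow> \<bar>e y i - e z i\<bar> \<le> d/2)" for i
      by (rule higson_subpowerE[OF HSe p, of "d/2"]) (use I(2) in auto)
    then obtain R where R: "\<And>i. \<forall>x\<in>X. dist x x0 > R i \<longrightarrow> (\<forall>y\<in>X. \<forall>z\<in>X. dist x y < p (dist x x0) \<longrightarrow>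
        dist x z < p (dist x x0) \<longrightarrow> \<bar>e y i - e z i\<bar> \<le> d/2)"
      by metis
    have "\<bar>f y - f z\<bar> \<le> \<epsilon>"
      if *: "x \<in> X" "dist x x0 > Max (insert 0 (R ` I))" "y \<in> X" "z \<in> X"
        "dist x y < p (dist x x0)" "dist x z < p (dist x x0)" for x y z
    proof -
      have "\<bar>e y i - e z i\<bar> < d" if "i \<in> I" for i
      proof -
        have "dist x x0 > R i" using *(2) I(1) that by simp
        then have "\<bar>e y i - e z i\<bar> \<le> d/2" using R * by blast
        then show ?thesis using I(2) by linarith
      qed
      then have "\<bar>g (e y) - g (e z)\<bar> < \<epsilon>"
        using * e_sub by (intro I(3)) auto
      then show ?thesis using g(2) * by simp
    qed
    then show "\<exists>R. \<forall>x\<in>X. dist x x0 > R \<longrightarrow> (\<forall>y\<in>X. \<forall>z\<in>X. dist x y < p (dist x x0) \<longrightarrow>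
        dist x z < p (dist x x0) \<longrightarrow> \<bar>f y - f z\<bar> \<le> \<epsilon>)" by blast
  qed
  have "subpower_compactification X x0 (top_of_set K) e"
    unfolding subpower_compactification_def using comp ext res by auto
  then show ?thesis by (rule that)
qed

end

theory Submission
  imports Defs
begin

text \<open>
  To bound the dimension of the corona by \<open>n = asdim\<^sub>P X\<close>, cut \<open>X\<close> into the annuli
  \<open>2^(2^k) \<le> |x| \<le> 2^(2^(k+1))\<close>. On the annuli of one parity, families of a scale that is a small power
  of \<open>|x|\<close> glue to \<open>n + 1\<close> families, and these define open sets of the corona that refine a given cover,
  with multiplicity at most \<open>n + 1\<close> on the closure of those annuli. Shrinking the cover for the even
  annuli and then once more for the odd ones gives multiplicity at most \<open>n + 1\<close> everywhere.

  Conversely let \<open>dim \<nu>\<^sub>P X < m = asdim\<^sub>P X\<close> and take a cover of \<open>X\<close> by \<open>m + 1\<close> families (colours) of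
  scale \<open>r\<close>. The points close to all colours form bounded pieces that are far from each other. An
  isometry moves a piece to a distance from the basepoint comparable to a power of \<open>r\<close>, where the corona
  sees the scale \<open>r\<close>: there the cover of the piece by the \<open>m + 1\<close> colours shrinks to one without a
  common point and with Lebesgue number \<open>r^\<beta>\<close>. Gluing the pieces gives a cover of multiplicity
  \<open>m\<close>, hence \<open>m\<close> disjoint families, contradicting the choice of \<open>m\<close>.
\<close>

subsection \<open>Higson subpower functions and uniform exponents\<close>

text \<open>The Higson condition tests all subpower functions and none of them is largest, while
  asymptotic power dimension fixes nothing but exponents. What reconciles them is that for one
  function and one error the condition already holds up to distance |x|^\<beta> for a single \<beta>
  > 0. Constant factors and changes of exponent are then harmless, because \<alpha> is free.

  The two directions differ in what must be uniform. The corona ignores bounded sets, so its upper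
  bound needs families only at far points, with scales growing along the annuli. A bound for asdim_P
  needs the same r everywhere in X: cocompactness makes all places alike, and unboundedness with
  M-connectedness provides a target at distance between 2 r^a and 2 r^a + M. The exponent a is at
  least that of the diameters, so a moved piece stays in a shell of radii comparable to r^a, on
  which r is comparable to |x|^(1/a).\<close>

lemma D_disjointD:
  assumes "D_disjoint r \<U>" "U \<in> \<U>" "V \<in> \<U>" "U \<noteq> V" "x \<in> U" "y \<in> V"
  shows "r < dist x y"
proof -
  have "ereal r < (INF (x,y)\<in>U \<times> V. ereal (dist x y))"
    using assms unfolding D_disjoint_def by blast
  also have "\<dots> \<le> ereal (dist x y)"
    using INF_lower[of "(x,y)" "U \<times> V" "\<lambda>(x,y). ereal (dist x y)"] assms(5,6) by simp
  finally show ?thesis by simp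
qed

lemma D_disjointI:
  assumes "r < s" "\<And>U V x y. \<lbrakk>U \<in> \<U>; V \<in> \<U>; U \<noteq> V; x \<in> U; y \<in> V\<rbrakk> \<Longrightarrow> s \<le> dist x y"
  shows "D_disjoint r \<U>"
  unfolding D_disjoint_def
proof (intro ballI impI)
  fix U V assume "U \<in> \<U>" "V \<in> \<U>" "U \<noteq> V"
  then have "ereal s \<le> (INF (x,y)\<in>U \<times> V. ereal (dist x y))"
    using assms(2)[of U V] by (intro INF_greatest) auto
  with \<open>r < s\<close> show "ereal r < (INF (x,y)\<in>U \<times> V. ereal (dist x y))"
    by (metis ereal_less_eq(3) less_le_trans less_ereal.simps(1))
qed

text \<open>Along a sparse sequence, a subpower function may have the form \<open>t powr \<epsilon>\<close> with \<open>\<epsilon> \<rightarrow> 0\<close>: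
  it defeats every fixed exponent, whence the uniform exponent in the next lemma.\<close>

lemma asymptotically_subpower_sparse:
  fixes a :: "nat \<Rightarrow> real"
  assumes a: "strict_mono a" and a1: "\<And>k. a k \<ge> 1"
  shows "asymptotically_subpower
    (\<lambda>t. if t \<in> range a then t powr (1 / real (Suc (inv a t))) else 0)" (is "asymptotically_subpower ?p")
  unfolding asymptotically_subpower_def
proof (intro conjI allI impI)
  show "?p \<in> {0..} \<rightarrow> {0..}" by auto
  fix \<alpha> :: real assume "\<alpha> > 0"
  then obtain n where n: "1 / real (Suc n) < \<alpha>"
    using nat_approx_posE by blast
  have "?p t < t powr \<alpha>" if t: "t > a n" for t
  proof (cases "t \<in> range a")
    case True
    then obtain k where k: "t = a k" by blast
    with t a have "k > n" using strict_mono_less by blast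
    then have "1 / real (Suc k) < \<alpha>"
      using n by (smt (verit) frac_less2 of_nat_0_less_iff of_nat_less_iff Suc_mono zero_less_Suc)
    moreover have "t > 1" using t a1[of n] by simp
    moreover have "inv a t = k" using k strict_mono_imp_inj_on[OF a] by simp
    ultimately show ?thesis using True by simp
  next
    case False
    then show ?thesis using t a1[of n] by simp
  qed
  then show "\<exists>r0>0. \<forall>t>r0. ?p t < t powr \<alpha>"
    using a1[of n] by (intro exI[of _ "a n"]) auto
qed

lemma higson_subpower_uniform:
  assumes f: "higson_subpower X x0 f" and "e > 0"
  shows "\<exists>\<beta>>0. \<exists>R. \<forall>x\<in>X. \<forall>y\<in>X.
    R < dist x x0 \<longrightarrow> dist x y < dist x x0 powr \<beta> \<longrightarrow> \<bar>f x - f y\<bar> \<le> e" (is ?thesis)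
proof (rule ccontr)
  assume neg: "\<not> ?thesis"
  have bad: "\<exists>x\<in>X. R < dist x x0 \<and> (\<exists>y\<in>X. dist x y < dist x x0 powr \<beta> \<and> \<bar>f x - f y\<bar> > e)"
    if "\<beta> > 0" for \<beta> R
    using neg \<open>\<beta> > 0\<close> by (meson not_le)
  let ?P = "\<lambda>k x. x \<in> X \<and> dist x x0 \<ge> 1 \<and> dist x x0 \<ge> real k \<and>
     (\<exists>y\<in>X. dist x y < dist x x0 powr (1 / real (Suc k)) \<and> \<bar>f x - f y\<bar> > e)"
  have ex: "\<exists>x. ?P k x \<and> dist x x0 > R" for k R
    using bad[of "1 / real (Suc k)" "max R (max 1 (real k))"] by fastforce
  \<comment> \<open>Strictly increasing distances make \<open>a\<close> injective, so
    \<open>?p\<close> returns the exponent 1/(k+1) exactly at the distance of the k-th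
    counterexample.\<close>
  have "\<exists>\<xi>. \<forall>k. ?P k (\<xi> k) \<and> dist (\<xi> (Suc k)) x0 > dist (\<xi> k) x0"
    by (rule dependent_nat_choice) (use ex in blast)+
  then obtain \<xi> where \<xi>: "\<And>k. ?P k (\<xi> k)" "\<And>k. dist (\<xi> (Suc k)) x0 > dist (\<xi> k) x0"
    by blast
  define a where "a k = dist (\<xi> k) x0" for k
  have a: "strict_mono a" using \<xi>(2) by (simp add: a_def strict_mono_Suc_iff)
  let ?p = "\<lambda>t. if t \<in> range a then t powr (1 / real (Suc (inv a t))) else 0"
  have "asymptotically_subpower ?p"
    using \<xi>(1) by (intro asymptotically_subpower_sparse[OF a]) (simp add: a_def)
  then obtain R where R: "\<forall>x\<in>X. dist x x0 > R \<longrightarrow>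
    (\<forall>y\<in>X. \<forall>z\<in>X. dist x y < ?p (dist x x0) \<longrightarrow> dist x z < ?p (dist x x0) \<longrightarrow> \<bar>f y - f z\<bar> \<le> e)"
    by (rule higson_subpowerE[OF f _ \<open>e > 0\<close>])
  obtain k where k: "real k > R" using reals_Archimedean2 by blast
  have *: "\<xi> k \<in> X" "dist (\<xi> k) x0 > R" "dist (\<xi> k) x0 \<ge> 1" using \<xi>(1)[of k] k by auto
  obtain y where y: "y \<in> X" "dist (\<xi> k) y < dist (\<xi> k) x0 powr (1 / real (Suc k))" "\<bar>f (\<xi> k) - f y\<bar> > e"
    using \<xi>(1)[of k] by blast
  have "?p (dist (\<xi> k) x0) = dist (\<xi> k) x0 powr (1 / real (Suc k))"
    using strict_mono_imp_inj_on[OF a] unfolding a_def[symmetric] by simp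
  then have "\<bar>f (\<xi> k) - f y\<bar> \<le> e"
    using R * y(1,2) by (smt (verit) dist_self powr_gt_zero)
  with y(3) show False by simp
qed

section \<open>Bump functions whose width is a power of the distance to the basepoint\<close>

lemma powr_diff_le_diff:
  fixes u v g :: real
  assumes "1 \<le> v" "v \<le> u" "g \<le> 1"
  shows "u powr g - v powr g \<le> u - v"
proof -
  have "(u / v) powr g \<le> u / v"
    using assms powr_mono[of g 1 "u/v"] by simp
  then have "u powr g \<le> v powr g * (u / v)"
    using assms by (simp add: powr_divide field_simps)
  then have "u powr g - v powr g \<le> v powr g * (u / v - 1)"
    by (simp add: algebra_simps)
  also have "\<dots> \<le> v * (u / v - 1)"
    using assms powr_mono[of g 1 v] by (intro mult_right_mono) auto
  also have "\<dots> = u - v" using assms by (simp add: field_simps)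
  finally show ?thesis .
qed

text \<open>The width of the bump around \<open>E\<close> grows like a power of the distance to \<open>x0\<close>; this is
  what makes it Higson subpower.\<close>

definition power_bump :: "'a::metric_space \<Rightarrow> real \<Rightarrow> real \<Rightarrow> 'a set \<Rightarrow> 'a \<Rightarrow> real" where
  "power_bump x0 c g E x = max 0 (1 - c * infdist x E / (1 + dist x x0) powr g)"

lemma power_bump_range: "0 \<le> power_bump x0 c g E x" "c \<ge> 0 \<Longrightarrow> power_bump x0 c g E x \<le> 1"
  by (auto simp: power_bump_def infdist_nonneg)

lemma power_bump_eq_1: "x \<in> E \<Longrightarrow> power_bump x0 c g E x = 1"
  by (simp add: power_bump_def)

lemma infdist_less_obtain:
  assumes "infdist x E < d" "E \<noteq> {}"
  obtains y where "y \<in> E" "dist x y < d"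
  using assms by (auto simp: infdist_def cINF_less_iff)

lemma power_bump_obtain:
  assumes "t < power_bump x0 c g E x" "0 \<le> t" "c > 0" "E \<noteq> {}"
  obtains y where "y \<in> E" "dist x y < (1 - t) * (1 + dist x x0) powr g / c"
proof -
  have p: "(1 + dist x x0) powr g > 0"
    using zero_le_dist[of x x0] by (intro powr_gt_zero[THEN iffD2]) linarith
  have "t < 1 - c * infdist x E / (1 + dist x x0) powr g"
    using assms(1,2) by (simp add: power_bump_def less_max_iff_disj)
  then have "infdist x E < (1 - t) * (1 + dist x x0) powr g / c"
    using assms(3) p by (simp add: field_simps)
  then show ?thesis using infdist_less_obtain assms(4) that by blast
qed

text \<open>From \<open>y\<close> to \<open>z\<close> the numerator grows by at most
  \<open>c * dist y z\<close>, and the denominator drops by at most \<open>dist y z\<close>, as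
  powers with exponent at most 1 are 1-Lipschitz on [1, infinity). The drop is weighted by q = 1 -
  bump(y), at most 1, whence the extra 1 in \<open>c + 1\<close>.\<close>

lemma power_bump_diff_le:
  assumes "0 \<le> c" "0 \<le> g" "g \<le> 1"
  shows "power_bump x0 c g E y - power_bump x0 c g E z \<le> (c + 1) * dist y z / (1 + dist z x0) powr g"
proof -
  define \<rho> where "\<rho> x = (1 + dist x x0) powr g" for x
  have \<rho>1: "\<rho> x \<ge> 1" for x
    using assms(2) by (simp add: \<rho>_def ge_one_powr_ge_zero)
  have \<rho>d: "\<rho> y - \<rho> z \<le> dist y z"
  proof (cases "dist z x0 \<le> dist y x0")
    case True
    then have "\<rho> y - \<rho> z \<le> dist y x0 - dist z x0"
      using powr_diff_le_diff[of "1 + dist z x0" "1 + dist y x0" g] assms(3) by (simp add: \<rho>_def)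
    then show ?thesis using dist_triangle[of y x0 z] by simp
  next
    case False
    then have "\<rho> y \<le> \<rho> z" unfolding \<rho>_def using assms(2) by (intro powr_mono2) auto
    then show ?thesis using zero_le_dist[of y z] by linarith
  qed
  have pos: "0 \<le> (c + 1) * dist y z / \<rho> z" using assms(1) \<rho>1[of z] by simp
  show ?thesis
  proof (cases "power_bump x0 c g E y > 0")
    case False
    then have "power_bump x0 c g E y = 0" using power_bump_range(1)[of x0 c g E y] by linarith
    then show ?thesis using pos power_bump_range(1)[of x0 c g E z] by (simp add: \<rho>_def)
  next
    case True
    define q where "q = c * infdist y E / \<rho> y"
    have cy: "power_bump x0 c g E y = 1 - q"
      using True unfolding power_bump_def q_def \<rho>_def by simp
    have q: "0 \<le> q" "q \<le> 1"
      using True cy assms(1) \<rho>1[of y] by (auto simp: q_def infdist_nonneg)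
    have qy: "c * infdist y E = q * \<rho> y" using \<rho>1[of y] by (simp add: q_def)
    have "c * infdist z E \<le> c * infdist y E + c * dist y z"
      using infdist_triangle[of z E y] assms(1) by (metis dist_commute distrib_left mult_left_mono)
    also have "\<dots> = q * \<rho> z + q * (\<rho> y - \<rho> z) + c * dist y z"
      unfolding qy by (simp add: algebra_simps)
    also have "q * (\<rho> y - \<rho> z) \<le> dist y z"
      using mult_left_mono[OF \<rho>d q(1)] mult_right_mono[OF q(2), of "dist y z"] by simp
    finally have "c * infdist z E / \<rho> z \<le> (q * \<rho> z + dist y z + c * dist y z) / \<rho> z"
      using \<rho>1[of z] by (simp add: divide_right_mono)
    also have "\<dots> = q + (c + 1) * dist y z / \<rho> z"
      using \<rho>1[of z] by (simp add: field_simps)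
    finally show ?thesis using cy unfolding power_bump_def \<rho>_def by (simp add: le_max_iff_disj)
  qed
qed

text \<open>A ball of radius p(t) < t^(g/2) around a point at distance t stays beyond t/2, where the
  bump has Lipschitz constant of order t^(-g). Its variation there is at most 4(c+1) t^(-g/2), which
  tends to 0.\<close>

lemma higson_subpower_power_bump:
  assumes c: "0 \<le> c" and g: "0 < g" "g \<le> 1"
  shows "higson_subpower X x0 (power_bump x0 c g E)"
  unfolding higson_subpower_iff
proof (intro conjI allI impI)
  have lip: "(c + 1)-lipschitz_on X (power_bump x0 c g E)"
  proof (rule lipschitz_onI)
    fix y z
    have *: "power_bump x0 c g E y - power_bump x0 c g E z \<le> (c + 1) * dist y z" for y z
    proof -
      have "(1 + dist z x0) powr g \<ge> 1" using g by (simp add: ge_one_powr_ge_zero)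
      then have "(c + 1) * dist y z / (1 + dist z x0) powr g \<le> (c + 1) * dist y z / 1"
        using c by (intro divide_left_mono) auto
      then show ?thesis using power_bump_diff_le[of c g x0 E y z] c g by simp
    qed
    show "dist (power_bump x0 c g E y) (power_bump x0 c g E z) \<le> (c + 1) * dist y z"
      using *[of y z] *[of z y] by (simp add: dist_real_def dist_commute abs_le_iff)
  qed (use c in simp)
  show "continuous_on X (power_bump x0 c g E)"
    using lip by (rule lipschitz_on_continuous_on)
  show "bounded (power_bump x0 c g E ` X)"
    unfolding bounded_iff using power_bump_range(1)[of x0 c g E] power_bump_range(2)[OF c, of x0 g E] by (intro exI[of _ 1]) auto
  fix p and e :: real
  assume p: "asymptotically_subpower p" and "e > 0"
  then obtain r0 where r0: "\<And>t. t > r0 \<Longrightarrow> p t < t powr (g/2)"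
    unfolding asymptotically_subpower_def using g by (meson half_gt_zero)
  \<comment> \<open>Beyond 4 one has sqrt t <= t/2; the last bound is 4(c+1)/t^(g/2) <= e solved for
    t.\<close>
  define R where "R = max r0 (max 4 ((4 * (c + 1) / e) powr (2 / g)))"
  have "\<bar>power_bump x0 c g E y - power_bump x0 c g E z\<bar> \<le> e"
    if x: "dist x x0 > R" "dist x y < p (dist x x0)" "dist x z < p (dist x x0)" for x y z
  proof -
    define t where "t = dist x x0"
    have t: "t > r0" "t > 4" "t > (4 * (c + 1) / e) powr (2 / g)"
      using x(1) by (auto simp: R_def t_def)
    have pt: "p t < t powr (g/2)" using r0 t by simp
    also have "t powr (g/2) \<le> t powr (1/2)" using t g by (intro powr_mono) auto
    also have "t powr (1/2) \<le> t / 2"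
    proof -
      have "sqrt t * 2 \<le> sqrt t * sqrt t"
        using t by (intro mult_left_mono real_le_rsqrt) auto
      then show ?thesis using t by (simp add: powr_half_sqrt)
    qed
    finally have pt2: "p t < t/2" .
    have half: "t/2 \<le> 1 + dist w x0" if "dist x w < p t" for w
      using that pt2 dist_triangle[of x x0 w] by (simp add: t_def)
    have "(4 * (c + 1) / e) powr (2 / g) \<le> t" using t by simp
    then have "((4 * (c + 1) / e) powr (2 / g)) powr (g/2) \<le> t powr (g/2)"
      using g by (intro powr_mono2) auto
    then have big: "4 * (c + 1) / e \<le> t powr (g/2)"
      using g c \<open>e > 0\<close> by (simp add: powr_powr)
    have *: "power_bump x0 c g E y - power_bump x0 c g E z \<le> e" if "dist x y < p t" "dist x z < p t" for y z
    proof -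
      have "dist y z \<le> 2 * t powr (g/2)"
        using that pt dist_triangle[of y z x] by (simp add: dist_commute)
      then have "(c + 1) * dist y z \<le> (c + 1) * (2 * t powr (g/2))"
        using c by (intro mult_left_mono) auto
      moreover have "t powr g / 2 \<le> (1 + dist z x0) powr g"
      proof -
        have "t powr g / 2 \<le> t powr g / 2 powr g"
          using g powr_mono[of g 1 2] by (intro divide_left_mono) auto
        also have "\<dots> = (t/2) powr g" using t by (simp add: powr_divide)
        also have "\<dots> \<le> (1 + dist z x0) powr g"
          using half[OF that(2)] t g by (intro powr_mono2) auto
        finally show ?thesis .
      qed
      ultimately have "(c + 1) * dist y z / (1 + dist z x0) powr g \<le> (c + 1) * (2 * t powr (g/2)) / (t powr g / 2)"
        using c t by (intro frac_le) auto
      also have "\<dots> = 4 * (c + 1) / t powr (g/2)"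
      proof -
        have "t powr g = t powr (g/2) * t powr (g/2)" by (simp flip: powr_add)
        then show ?thesis using t by (simp add: field_simps)
      qed
      also have "\<dots> \<le> e"
        using big \<open>e > 0\<close> t by (simp add: field_simps)
      finally show ?thesis using power_bump_diff_le[of c g x0 E y z] c g by simp
    qed
    show ?thesis using *[of y z] *[of z y] x(2,3) by (simp add: t_def abs_le_iff)
  qed
  then show "\<exists>R. \<forall>x\<in>X. dist x x0 > R \<longrightarrow> (\<forall>y\<in>X. \<forall>z\<in>X. dist x y < p (dist x x0) \<longrightarrow>
      dist x z < p (dist x x0) \<longrightarrow> \<bar>power_bump x0 c g E y - power_bump x0 c g E z\<bar> \<le> e)" by blast
qed

subsection \<open>Approximating corona points from \<open>X\<close>\<close>

lemma openin_less_const: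
  assumes "continuous_map H euclideanreal f"
  shows "openin H {z \<in> topspace H. f z < c}" "openin H {z \<in> topspace H. c < f z}"
  using openin_continuous_map_preimage[OF assms, of "{..<c}"]
    openin_continuous_map_preimage[OF assms, of "{c<..}"] by simp_all

lemma closedin_le_const:
  assumes "continuous_map H euclideanreal f"
  shows "closedin H {z \<in> topspace H. f z \<le> c}" "closedin H {z \<in> topspace H. c \<le> f z}"
  using closedin_continuous_map_preimage[OF assms, of "{..c}"]
    closedin_continuous_map_preimage[OF assms, of "{c..}"] by simp_all

lemma finite_closedin_Inter:
  assumes "finite I" "\<And>i. i \<in> I \<Longrightarrow> closedin H {z \<in> topspace H. P i z}"
  shows "closedin H {z \<in> topspace H. \<forall>i\<in>I. P i z}"
proof (cases "I = {}")
  case False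
  have "{z \<in> topspace H. \<forall>i\<in>I. P i z} = (\<Inter>i\<in>I. {z \<in> topspace H. P i z})"
    using False by blast
  then show ?thesis using assms False by (metis (no_types, lifting) closedin_INT)
qed simp

lemma finite_openin_Inter:
  assumes "finite I" "\<And>i. i \<in> I \<Longrightarrow> openin H {z \<in> topspace H. P i z}"
  shows "openin H {z \<in> topspace H. \<forall>i\<in>I. P i z}"
  using assms
proof (induction I)
  case (insert i I)
  have "{z \<in> topspace H. \<forall>j\<in>insert i I. P j z} =
    {z \<in> topspace H. P i z} \<inter> {z \<in> topspace H. \<forall>j\<in>I. P j z}" by blast
  then show ?case using insert by (metis (no_types, lifting) insertCI openin_Int)
qed simp

locale subpower_corona =
  fixes X :: "'a::metric_space set" and x0 :: 'a and H :: "'b topology" and \<iota> :: "'a \<Rightarrow> 'b"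
  assumes proper: "proper_space X" and x0: "x0 \<in> X"
    and comp: "subpower_compactification X x0 H \<iota>"
begin

definition \<nu> :: "'b set" where "\<nu> = topspace H - \<iota> ` X"

lemma compact_H: "compact_space H" and Hausdorff_H: "Hausdorff_space H"
  and emb: "embedding_map (top_of_set X) H \<iota>" and dense: "H closure_of (\<iota> ` X) = topspace H"
  using comp unfolding subpower_compactification_def compactification_def by simp_all

lemma corona_eq: "corona X H \<iota> = subtopology H \<nu>"
  by (simp add: corona_def \<nu>_def)

lemma continuous_iota: "continuous_map (top_of_set X) H \<iota>"
  using emb homeomorphic_imp_continuous_map continuous_map_into_fulltopology
  unfolding embedding_map_def by blast

lemma iota_in: "x \<in> X \<Longrightarrow> \<iota> x \<in> topspace H"
  using continuous_map_image_subset_topspace[OF continuous_iota] by auto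

lemma topspace_corona: "topspace (corona X H \<iota>) = \<nu>"
  by (auto simp: corona_def \<nu>_def)

lemma hom_iota: "homeomorphic_map (top_of_set X) (subtopology H (\<iota> ` X)) \<iota>"
  using emb by (simp add: embedding_map_def)

lemma compact_image_iff: "K \<subseteq> X \<Longrightarrow> compactin H (\<iota> ` K) \<longleftrightarrow> compact K"
  using homeomorphic_map_compactness[OF hom_iota, of K]
  by (simp add: compactin_subtopology compactin_euclidean_iff image_mono)

lemma closed_ball_image: "closedin H (\<iota> ` (cball x0 R \<inter> X))"
  using proper x0 compactin_imp_closedin[OF Hausdorff_H] compact_image_iff
  by (simp add: proper_space_def)

text \<open>Properness makes X locally compact, and a dense locally compact subspace of a Hausdorff
  space is open.\<close>

lemma closed_corona: "closedin H \<nu>"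
proof -
  have "locally_compact_space (top_of_set X)"
    unfolding locally_compact_space_def
  proof (intro ballI)
    fix x assume "x \<in> topspace (top_of_set X)"
    then have x: "x \<in> X" by simp
    have "compactin (top_of_set X) (cball x 1 \<inter> X)"
      using proper x by (simp add: proper_space_def compactin_subtopology compactin_euclidean_iff)
    moreover have "openin (top_of_set X) (ball x 1 \<inter> X)"
      by (simp add: Int_commute openin_open_Int)
    ultimately show "\<exists>U K. openin (top_of_set X) U \<and> compactin (top_of_set X) K \<and> x \<in> U \<and> U \<subseteq> K"
      using x by (intro exI[of _ "ball x 1 \<inter> X"] exI[of _ "cball x 1 \<inter> X"]) auto
  qed
  then have "locally_compact_space (subtopology H (\<iota> ` X))"
    using hom_iota homeomorphic_locally_compact_space homeomorphic_map_imp_homeomorphic_space by blast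
  then have "openin H (\<iota> ` X)"
    using iota_in dense by (intro dense_locally_compact_openin_Hausdorff_space[OF Hausdorff_H]) auto
  then show ?thesis unfolding \<nu>_def by blast
qed

text \<open>Such a \<open>C\<close> is a compact subset of the embedded X, hence bounded. This leads
  from the corona back to X: a closed condition that fails on the whole corona fails at all points
  of X outside some ball.\<close>

lemma far_from_corona:
  assumes "closedin H C" "C \<inter> \<nu> = {}"
  obtains R where "\<And>x. x \<in> X \<Longrightarrow> \<iota> x \<in> C \<Longrightarrow> dist x x0 \<le> R"
proof -
  have "C \<subseteq> \<iota> ` X" using assms closedin_subset unfolding \<nu>_def by blast
  then have C: "\<iota> ` {x \<in> X. \<iota> x \<in> C} = C" by blast
  moreover have "compactin H C" using assms(1) compact_H closedin_compact_space by blast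
  ultimately have "compact {x \<in> X. \<iota> x \<in> C}" using compact_image_iff[of "{x \<in> X. \<iota> x \<in> C}"] by simp
  then obtain R where "\<forall>x\<in>{x \<in> X. \<iota> x \<in> C}. dist x0 x \<le> R"
    using compact_imp_bounded bounded_any_center[of _ x0] by metis
  then show ?thesis by (intro that[of R]) (auto simp: dist_commute)
qed

text \<open>Closed balls of X have closed image missing \<open>z\<close>, so they can be removed
  from any neighbourhood of \<open>z\<close>. This leads from X to the corona: an open condition at
  \<open>z\<close> holds at points of \<open>S\<close> arbitrarily far out.\<close>

lemma approx_corona:
  assumes z: "z \<in> \<nu>" "z \<in> H closure_of (\<iota> ` S)" and U: "openin H U" "z \<in> U" and "S \<subseteq> X"
  obtains x where "x \<in> S" "\<iota> x \<in> U" "dist x x0 > R"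
proof -
  have "openin H (U - \<iota> ` (cball x0 R \<inter> X))"
    using U(1) closed_ball_image by (simp add: openin_diff)
  moreover have "z \<in> U - \<iota> ` (cball x0 R \<inter> X)" using U(2) z(1) by (auto simp: \<nu>_def)
  ultimately obtain x where "x \<in> S" "\<iota> x \<in> U - \<iota> ` (cball x0 R \<inter> X)"
    using z(2) unfolding in_closure_of by blast
  then show ?thesis using \<open>S \<subseteq> X\<close> by (intro that[of x]) (auto simp: dist_commute)
qed

lemma approx_corona':
  assumes z: "z \<in> \<nu>" and U: "openin H U" "z \<in> U"
  obtains x where "x \<in> X" "\<iota> x \<in> U" "dist x x0 > R"
  using approx_corona[of z X U R] assms dense unfolding \<nu>_def by blast

section \<open>Continuous functions on the compactification and their oscillation on X\<close>

lemma restrict_higson: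
  assumes "continuous_map H euclideanreal g"
  shows "higson_subpower X x0 (\<lambda>x. g (\<iota> x))"
proof -
  have "continuous_map (top_of_set X) euclideanreal (g \<circ> \<iota>)"
    using continuous_map_compose[OF continuous_iota assms] .
  then have c: "continuous_on X (\<lambda>x. g (\<iota> x))" by (simp add: o_def)
  have "compactin euclideanreal (g ` topspace H)"
    using image_compactin assms compact_H compact_space_def by blast
  then have "bounded (g ` topspace H)" by (simp add: compact_imp_bounded compactin_euclidean_iff)
  moreover have "(\<lambda>x. g (\<iota> x)) ` X \<subseteq> g ` topspace H" using iota_in by blast
  ultimately have "bounded ((\<lambda>x. g (\<iota> x)) ` X)" by (rule bounded_subset)
  then show ?thesis using comp c assms unfolding subpower_compactification_def by blast
qed

lemma extend_higson:
  assumes "higson_subpower X x0 f"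
  obtains g where "continuous_map H euclideanreal g" "\<And>x. x \<in> X \<Longrightarrow> g (\<iota> x) = f x"
proof -
  have "continuous_on X f \<and> bounded (f ` X)"
    using assms by (simp add: higson_subpower_def)
  then have "\<exists>g. continuous_map H euclideanreal g \<and> (\<forall>x\<in>X. g (\<iota> x) = f x)"
    using comp assms unfolding subpower_compactification_def by blast
  then show ?thesis using that by blast
qed

lemma power_bump_extensions:
  assumes "0 \<le> c" "0 < g" "g \<le> 1"
  obtains F where "\<And>E. continuous_map H euclideanreal (F E)"
    "\<And>E x. x \<in> X \<Longrightarrow> F E (\<iota> x) = power_bump x0 c g E x"
proof -
  have "\<exists>F. continuous_map H euclideanreal F \<and> (\<forall>x\<in>X. F (\<iota> x) = power_bump x0 c g E x)" for E
    by (rule extend_higson[OF higson_subpower_power_bump[OF assms, of X x0 E]]) blast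
  then obtain F where "\<forall>E. continuous_map H euclideanreal (F E) \<and> (\<forall>x\<in>X. F E (\<iota> x) = power_bump x0 c g E x)"
    by meson
  then show ?thesis using that[of F] by blast
qed

lemma uniform_family:
  assumes "finite I" "\<And>i. i \<in> I \<Longrightarrow> continuous_map H euclideanreal (u i)" "e > 0"
  obtains \<beta> R where "0 < \<beta>" "\<beta> \<le> 1" "1 \<le> R"
    "\<And>i x y. \<lbrakk>i \<in> I; x \<in> X; y \<in> X; R < dist x x0; dist x y < dist x x0 powr \<beta>\<rbrakk>
      \<Longrightarrow> \<bar>u i (\<iota> x) - u i (\<iota> y)\<bar> \<le> e"
proof -
  have "\<exists>b>0. \<exists>R. \<forall>x\<in>X. \<forall>y\<in>X. R < dist x x0 \<longrightarrow> dist x y < dist x x0 powr b \<longrightarrow>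
    \<bar>u i (\<iota> x) - u i (\<iota> y)\<bar> \<le> e" if "i \<in> I" for i
    using higson_subpower_uniform[OF restrict_higson[OF assms(2)[OF that]] assms(3)] .
  then obtain b R where b: "\<And>i. i \<in> I \<Longrightarrow> b i > 0"
    "\<And>i x y. \<lbrakk>i \<in> I; x \<in> X; y \<in> X; R i < dist x x0; dist x y < dist x x0 powr b i\<rbrakk>
      \<Longrightarrow> \<bar>u i (\<iota> x) - u i (\<iota> y)\<bar> \<le> e" by metis
  \<comment> \<open>The inserted 1 keeps both extrema defined for empty \<open>I\<close>; radii of
    at least 1 also make |x|^\<beta> monotone in the exponent.\<close>
  define \<beta> where "\<beta> = Min (insert 1 (b ` I))"
  define R' where "R' = Max (insert 1 (R ` I))"
  have 1: "0 < \<beta>" "\<beta> \<le> 1" "1 \<le> R'" "\<And>i. i \<in> I \<Longrightarrow> \<beta> \<le> b i" "\<And>i. i \<in> I \<Longrightarrow> R i \<le> R'"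
    using assms(1) b(1) by (auto simp: \<beta>_def R'_def)
  have "\<bar>u i (\<iota> x) - u i (\<iota> y)\<bar> \<le> e"
    if *: "i \<in> I" "x \<in> X" "y \<in> X" "R' < dist x x0" "dist x y < dist x x0 powr \<beta>" for i x y
  proof -
    have "dist x x0 powr \<beta> \<le> dist x x0 powr b i"
      using 1 * by (intro powr_mono) auto
    then show ?thesis using b(2)[of i x y] 1(5)[of i] * by fastforce
  qed
  with 1 show ?thesis using that by blast
qed

text \<open>An unnormalised partition of unity: complete regularity gives a function at each point
  of \<open>Z\<close>, compactness leaves finitely many, and those with the same index are added.
  The gap between 0 off \<open>U i\<close> and a value above 1 on \<open>Z\<close> leaves room for
  the oscillation tolerated later.\<close>

lemma subordinate_functions:
  assumes fin: "finite I" and Z: "closedin H Z" "Z \<subseteq> \<nu>"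
    and U: "\<And>i. i \<in> I \<Longrightarrow> openin (corona X H \<iota>) (U i)" and cov: "Z \<subseteq> (\<Union>i\<in>I. U i)"
  obtains u :: "'i \<Rightarrow> 'b \<Rightarrow> real" where "\<And>i. continuous_map H euclideanreal (u i)"
    "\<And>i z. i \<in> I \<Longrightarrow> z \<in> \<nu> \<Longrightarrow> z \<notin> U i \<Longrightarrow> u i z = 0" "\<And>z. z \<in> Z \<Longrightarrow> \<exists>i\<in>I. u i z > 1"
proof -
  have cr: "completely_regular_space H"
    using normal_imp_completely_regular_space compact_Hausdorff_or_regular_imp_normal_space
      compact_H Hausdorff_H by blast
  have "\<exists>i w. i \<in> I \<and> continuous_map H euclideanreal w \<and> w z = (3::real) \<and> (\<forall>y. 0 \<le> w y) \<and> (\<forall>y\<in>\<nu> - U i. w y = 0)"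
    if z: "z \<in> Z" for z
  proof -
    obtain i where i: "i \<in> I" "z \<in> U i" using cov z by blast
    have "closedin (corona X H \<iota>) (\<nu> - U i)"
      using U[OF i(1)] by (metis closedin_def closedin_diff closedin_topspace topspace_corona)
    then have "closedin H (\<nu> - U i)"
      using closed_corona unfolding corona_eq by (rule closedin_trans_full)
    moreover have "z \<in> topspace H - (\<nu> - U i)" using i z Z by (auto simp: \<nu>_def)
    ultimately obtain f where f: "continuous_map H (top_of_set {0..1::real}) f" "f z = 0" "f ` (\<nu> - U i) \<subseteq> {1}"
      using cr unfolding completely_regular_space_def by blast
    have fc: "continuous_map H euclideanreal f"
      using f(1) by (auto simp: continuous_map_in_subtopology)
    have "continuous_map H euclideanreal (\<lambda>y. max 0 (3 * (1 - f y)))"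
      by (intro continuous_intros fc)
    moreover have "\<forall>y\<in>\<nu> - U i. max 0 (3 * (1 - f y)) = 0" using f(3) by auto
    ultimately show ?thesis using i(1) f(2)
      by (intro exI[of _ i] exI[of _ "\<lambda>y. max 0 (3 * (1 - f y))"]) simp
  qed
  then have "\<forall>z\<in>Z. \<exists>iw. fst iw \<in> I \<and> continuous_map H euclideanreal (snd iw) \<and> snd iw z = (3::real) \<and>
      (\<forall>y. 0 \<le> snd iw y) \<and> (\<forall>y\<in>\<nu> - U (fst iw). snd iw y = 0)"
    by simp
  then obtain iw where iw: "\<forall>z\<in>Z. fst (iw z) \<in> I \<and> continuous_map H euclideanreal (snd (iw z)) \<and>
      snd (iw z) z = (3::real) \<and> (\<forall>y. 0 \<le> snd (iw z) y) \<and> (\<forall>y\<in>\<nu> - U (fst (iw z)). snd (iw z) y = 0)"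
    by (rule bchoice[THEN exE])
  define ind where "ind z = fst (iw z)" for z
  define w where "w z = snd (iw z)" for z
  have w: "\<And>z. z \<in> Z \<Longrightarrow> ind z \<in> I"
    "\<And>z. z \<in> Z \<Longrightarrow> continuous_map H euclideanreal (w z)" "\<And>z. z \<in> Z \<Longrightarrow> w z z = (3::real)"
    "\<And>z y. z \<in> Z \<Longrightarrow> 0 \<le> w z y" "\<And>z y. z \<in> Z \<Longrightarrow> y \<in> \<nu> - U (ind z) \<Longrightarrow> w z y = 0"
    using iw by (simp_all add: ind_def w_def)
  have "compactin H Z" using Z(1) compact_H closedin_compact_space by blast
  moreover have "openin H {y \<in> topspace H. 1 < w z y}" if "z \<in> Z" for z
    by (rule openin_less_const(2)[OF w(2)[OF that]])
  moreover have "Z \<subseteq> (\<Union>z\<in>Z. {y \<in> topspace H. 1 < w z y})"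
    using w(3) Z by (force simp: \<nu>_def)
  ultimately have "\<exists>\<F>. finite \<F> \<and> \<F> \<subseteq> (\<lambda>z. {y \<in> topspace H. 1 < w z y}) ` Z \<and> Z \<subseteq> \<Union>\<F>"
    by (simp add: compactin_def)
  then obtain A where A: "finite A" "A \<subseteq> Z" "Z \<subseteq> (\<Union>z\<in>A. {y \<in> topspace H. 1 < w z y})"
    using finite_subset_image by (metis (no_types, lifting))
  define u where "u i y = (\<Sum>z\<in>{z\<in>A. ind z = i}. w z y)" for i y
  have "continuous_map H euclideanreal (u i)" for i
    unfolding u_def using A w(2) by (intro continuous_intros) auto
  moreover have "u i y = 0" if "y \<in> \<nu>" "y \<notin> U i" for i y
    unfolding u_def using A(2) w(5) that by (intro sum.neutral) auto
  moreover have "\<exists>i\<in>I. u i y > 1" if "y \<in> Z" for y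
  proof -
    obtain z where z: "z \<in> A" "w z y > 1" using A(3) \<open>y \<in> Z\<close> by blast
    have "w z y \<le> u (ind z) y"
      unfolding u_def using A z w(4) by (intro member_le_sum) auto
    then show ?thesis using z A(2) w(1)[of z] by (intro bexI[of _ "ind z"]) auto
  qed
  ultimately show ?thesis using that by blast
qed
end

subsection \<open>The upper bound for the dimension of the corona\<close>

lemma double_exp_ge: "real k \<le> 2 ^ 2 ^ k"
proof -
  have "real k < 2 ^ k" by (rule of_nat_less_two_power)
  also have "(2::real) ^ k \<le> 2 ^ 2 ^ k" by (intro power_increasing) (auto simp: less_imp_le)
  finally show ?thesis by simp
qed

context subpower_corona
begin

text \<open>The radii square from one annulus to the next, so on an annulus of inner radius T a
  power of T and a power of |x| differ by at most a factor 2 in the exponent.\<close>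

definition annulus :: "nat \<Rightarrow> 'a set" where
  "annulus k = {x \<in> X. 2 ^ 2 ^ k \<le> dist x x0 \<and> dist x x0 \<le> 2 ^ 2 ^ Suc k}"

definition annuli :: "bool \<Rightarrow> 'a set" where
  "annuli q = (\<Union>k\<in>{k. even k = q}. annulus k)"

lemma annuli_cover:
  assumes "x \<in> X" "2 < dist x x0"
  shows "x \<in> annuli True \<union> annuli False"
proof -
  obtain m where "dist x x0 \<le> real m" using real_arch_simple by blast
  then have "dist x x0 \<le> 2 ^ 2 ^ Suc m"
    using double_exp_ge[of "Suc m"] by simp
  define k where "k = (LEAST k. dist x x0 \<le> 2 ^ 2 ^ Suc k)"
  have k: "dist x x0 \<le> 2 ^ 2 ^ Suc k"
    unfolding k_def by (rule LeastI[of _ m]) fact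
  have "2 ^ 2 ^ k \<le> dist x x0"
  proof (cases k)
    case (Suc j)
    then have "\<not> dist x x0 \<le> 2 ^ 2 ^ Suc j" using not_less_Least[of j "\<lambda>k. dist x x0 \<le> 2 ^ 2 ^ Suc k"]
      unfolding k_def by (metis lessI)
    then show ?thesis unfolding Suc by simp
  qed (use assms in simp)
  then have "x \<in> annulus k" using k assms(1) by (simp add: annulus_def)
  then show ?thesis by (auto simp: annuli_def)
qed

lemma corona_subset_annuli:
  "\<nu> \<subseteq> H closure_of (\<iota> ` annuli True) \<union> H closure_of (\<iota> ` annuli False)"
proof
  fix z assume z: "z \<in> \<nu>"
  show "z \<in> H closure_of (\<iota> ` annuli True) \<union> H closure_of (\<iota> ` annuli False)"
  proof (rule ccontr)
    assume n: "\<not> ?thesis"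
    let ?A = "\<lambda>q. H closure_of (\<iota> ` annuli q)"
    have "openin H (topspace H - (?A True \<union> ?A False))"
      by (intro openin_diff) auto
    moreover have "z \<in> topspace H - (?A True \<union> ?A False)" using n z by (auto simp: \<nu>_def)
    ultimately obtain x where x: "x \<in> X" "\<iota> x \<in> topspace H - (?A True \<union> ?A False)" "dist x x0 > 2"
      by (rule approx_corona'[OF z])
    have "\<iota> x \<in> ?A q" if "x \<in> annuli q" for q
      using that x(2) by (auto intro: subsetD[OF closure_of_subset_Int])
    then show False using annuli_cover[OF x(1,3)] x(2) by blast
  qed
qed

text \<open>Annuli of equal parity are separated by a whole annulus: if T is the outer radius of the
  \<open>k\<close>-th one, the next of that parity starts at T^2, and T >= 16 for k >= 1 beats the
  factor 4.\<close>

lemma annulus_unique: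
  assumes y: "y \<in> annulus k" and y': "y' \<in> annulus k'" and "even k = even k'" "1 \<le> k"
    and d: "dist y' x0 \<le> 4 * dist y x0"
  shows "k' \<le> k"
proof (rule ccontr)
  assume "\<not> k' \<le> k"
  with \<open>even k = even k'\<close> have k': "Suc (Suc k) \<le> k'"
    by (metis Suc_leI even_Suc le_neq_implies_less not_less)
  define T :: real where "T = 2 ^ 2 ^ Suc k"
  have "(2::nat) ^ 2 ^ 2 \<le> 2 ^ 2 ^ Suc k"
    using \<open>1 \<le> k\<close> by (intro power_increasing) auto
  then have "(16::nat) \<le> 2 ^ 2 ^ Suc k" by simp
  then have T: "16 \<le> T" unfolding T_def by (metis of_nat_le_iff of_nat_numeral of_nat_power)
  have "T * T = 2 ^ 2 ^ Suc (Suc k)"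
    by (simp add: T_def mult_2 flip: power_add)
  also have "\<dots> \<le> (2::real) ^ 2 ^ k'"
    using k' by (intro power_increasing) auto
  also have "\<dots> \<le> dist y' x0" using y' by (simp add: annulus_def)
  also have "\<dots> \<le> 4 * T" using d y by (auto simp: annulus_def T_def)
  finally show False using T by simp
qed

text \<open>Each set of colour c is labelled by an index i whose \<open>u i\<close> is large on it,
  and \<open>W c i\<close> is the trace at infinity of a neighbourhood of the sets of colour c with
  label i. Near a far point there is at most one set of each colour, hence one label per colour. Off
  the closure of these annuli \<open>U i\<close> is kept unchanged, so that a cover remains.\<close>

lemma shrink_on_annuli:
  assumes asdim: "asdimP_le X n" and fin: "finite I"
    and U: "\<And>i. i \<in> I \<Longrightarrow> openin (corona X H \<iota>) (U i)" and cov: "(\<Union>i\<in>I. U i) = \<nu>"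
  obtains V where "\<And>i. i \<in> I \<Longrightarrow> openin (corona X H \<iota>) (V i)" "\<And>i. i \<in> I \<Longrightarrow> V i \<subseteq> U i"
    "(\<Union>i\<in>I. V i) = \<nu>"
    "\<And>z. z \<in> \<nu> \<Longrightarrow> z \<in> H closure_of (\<iota> ` annuli q) \<Longrightarrow> card {i \<in> I. z \<in> V i} \<le> Suc n"
proof -
  obtain u :: "'c \<Rightarrow> 'b \<Rightarrow> real" where u: "\<And>i. continuous_map H euclideanreal (u i)"
    "\<And>i z. i \<in> I \<Longrightarrow> z \<in> \<nu> \<Longrightarrow> z \<notin> U i \<Longrightarrow> u i z = 0" "\<And>z. z \<in> \<nu> \<Longrightarrow> \<exists>i\<in>I. u i z > 1"
    by (rule subordinate_functions[OF fin closed_corona subset_refl U equalityD2[OF cov]]) blast+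
  \<comment> \<open>Two losses of 1/4 are planned: from above 1 to 3/4 within one set of a family,
    then to 1/2 at points near that set.\<close>
  obtain \<beta> R where \<beta>: "0 < \<beta>" "\<beta> \<le> 1" "1 \<le> R" and
    osc: "\<And>i x y. \<lbrakk>i \<in> I; x \<in> X; y \<in> X; R < dist x x0; dist x y < dist x x0 powr \<beta>\<rbrakk>
      \<Longrightarrow> \<bar>u i (\<iota> x) - u i (\<iota> y)\<bar> \<le> 1/4"
    by (rule uniform_family[where u = u and e = "1/4" and I = I]) (use fin u(1) in auto)
  have "closedin H {z \<in> topspace H. \<forall>i\<in>I. u i z \<le> 1}"
    using fin u(1) by (intro finite_closedin_Inter closedin_le_const)
  moreover have "{z \<in> topspace H. \<forall>i\<in>I. u i z \<le> 1} \<inter> \<nu> = {}" using u(3) by fastforce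
  ultimately obtain R1 where R1: "\<And>x. x \<in> X \<Longrightarrow> \<iota> x \<in> {z \<in> topspace H. \<forall>i\<in>I. u i z \<le> 1} \<Longrightarrow> dist x x0 \<le> R1"
    by (rule far_from_corona) blast
  have u1: "\<exists>i\<in>I. u i (\<iota> x) > 1" if "x \<in> X" "dist x x0 > R1" for x
    using R1[OF that(1)] that iota_in[OF that(1)] by fastforce
  obtain \<alpha> r0 where \<alpha>: "\<alpha> > 0" "r0 > 0" and fam: "\<forall>r>r0. \<exists>\<U> :: nat \<Rightarrow> 'a set set.
        (\<forall>i\<le>n. \<U> i \<subseteq> Pow X \<and> D_disjoint r (\<U> i) \<and> D_bounded (r powr \<alpha>) (\<U> i)) \<and>
        \<Union> (\<Union>i\<le>n. \<U> i) = X"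
    using asdim unfolding asdimP_le_def by blast
  \<comment> \<open>For families of scale T^\<delta>, \<delta> * \<alpha> < \<beta> puts the
    diameters below the oscillation scale T^\<beta>, and \<delta> <= \<beta> does the same for
    neighbourhoods of radius T^\<delta> / 2.\<close>
  define \<delta> where "\<delta> = min \<beta> (\<beta> / (2 * \<alpha>))"
  have \<delta>: "0 < \<delta>" "\<delta> \<le> \<beta>" "\<delta> \<le> 1" "\<delta> * \<alpha> < \<beta>"
  proof -
    have "\<delta> * \<alpha> \<le> \<beta> / (2 * \<alpha>) * \<alpha>" using \<alpha> by (intro mult_right_mono) (auto simp: \<delta>_def)
    then show "\<delta> * \<alpha> < \<beta>" using \<alpha> \<beta> by simp
  qed (use \<alpha> \<beta> in \<open>auto simp: \<delta>_def\<close>)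
  define T :: "nat \<Rightarrow> real" where "T k = 2 ^ 2 ^ k" for k
  have T2: "T (Suc k) = T k * T k" for k
    by (simp add: T_def mult_2 flip: power_add)
  have ann: "x \<in> X" "T k \<le> dist x x0" "dist x x0 \<le> T k * T k" if "x \<in> annulus k" for x k
    using that unfolding T2[symmetric] by (auto simp: annulus_def T_def)
  obtain k0 :: nat where "max (max 1 (r0 powr (1/\<delta>))) (max R R1) < real k0"
    using reals_Archimedean2 by blast
  then have k0: "1 < real k0" "r0 powr (1/\<delta>) < real k0" "R < real k0" "R1 < real k0" by auto
  have Tk: "1 < T k" "R < T k" "R1 < T k" "r0 < T k powr \<delta>" if "k0 \<le> k" for k
  proof -
    have *: "real k0 \<le> T k" using double_exp_ge[of k] that by (simp add: T_def)
    then show "1 < T k" "R < T k" "R1 < T k" using k0 by auto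
    have "(r0 powr (1/\<delta>)) powr \<delta> < T k powr \<delta>" using k0 * \<delta> by (intro powr_less_mono2) auto
    then show "r0 < T k powr \<delta>" using \<alpha> \<delta> by (simp add: powr_powr)
  qed
  define good where "good k \<U> \<longleftrightarrow>
        (\<forall>i\<le>n. \<U> i \<subseteq> Pow X \<and> D_disjoint (T k powr \<delta>) (\<U> i) \<and> D_bounded ((T k powr \<delta>) powr \<alpha>) (\<U> i)) \<and>
        \<Union> (\<Union>i\<le>n. \<U> i) = X" for k and \<U> :: "nat \<Rightarrow> 'a set set"
  have "\<exists>\<U>. good k \<U>" if "k0 \<le> k" for k
    unfolding good_def by (rule fam[THEN spec, THEN mp, OF Tk(4)[OF that]])
  then obtain \<U> where \<U>0: "\<And>k. k0 \<le> k \<Longrightarrow> good k (\<U> k)"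
    by metis
  have \<U>: "D_disjoint (T k powr \<delta>) (\<U> k c)" "D_bounded ((T k powr \<delta>) powr \<alpha>) (\<U> k c)" "\<And>A. A \<in> \<U> k c \<Longrightarrow> A \<subseteq> X"
    if "k0 \<le> k" "c \<le> n" for k c
    using \<U>0[OF that(1)] that(2) unfolding good_def by auto
  have \<U>cov: "\<exists>c\<le>n. \<exists>A\<in>\<U> k c. x \<in> A" if "k0 \<le> k" "x \<in> X" for k x
  proof -
    have "x \<in> \<Union> (\<Union>i\<le>n. \<U> k i)" using \<U>0[OF that(1)] that(2) unfolding good_def by simp
    then show ?thesis by auto
  qed
  define lab where "lab k A = (SOME i. i \<in> I \<and> (\<forall>x\<in>A \<inter> annulus k. u i (\<iota> x) \<ge> 3/4))" for k A
  have lab: "lab k A \<in> I \<and> (\<forall>x\<in>A \<inter> annulus k. u (lab k A) (\<iota> x) \<ge> 3/4)"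
    if k: "k0 \<le> k" "c \<le> n" and A: "A \<in> \<U> k c" and a: "a \<in> A" "a \<in> annulus k" for k c A a
    unfolding lab_def
  proof (rule someI_ex)
    note a' = ann[OF a(2)]
    obtain i where i: "i \<in> I" "u i (\<iota> a) > 1"
      using u1[of a] a' Tk[OF k(1)] by force
    have "u i (\<iota> x) \<ge> 3/4" if x: "x \<in> A \<inter> annulus k" for x
    proof -
      have "dist a x \<le> diameter A"
        using \<U>(2)[OF k] A a x unfolding D_bounded_def by (intro diameter_bounded_bound) auto
      also have "\<dots> \<le> (T k powr \<delta>) powr \<alpha>" using \<U>(2)[OF k] A unfolding D_bounded_def by blast
      also have "\<dots> = T k powr (\<delta> * \<alpha>)" by (simp add: powr_powr)
      also have "\<dots> < T k powr \<beta>" using Tk[OF k(1)] \<delta> by (intro powr_less_mono) auto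
      also have "\<dots> \<le> dist a x0 powr \<beta>" using Tk[OF k(1)] a' \<beta> by (intro powr_mono2) auto
      finally have "\<bar>u i (\<iota> a) - u i (\<iota> x)\<bar> \<le> 1/4"
        using i a' x Tk[OF k(1)] by (intro osc) (auto simp: annulus_def)
      then show ?thesis using i by linarith
    qed
    then show "\<exists>i. i \<in> I \<and> (\<forall>x\<in>A \<inter> annulus k. u i (\<iota> x) \<ge> 3/4)" using i by blast
  qed
  define P where "P c i k A y \<longleftrightarrow> k0 \<le> k \<and> even k = q \<and> y \<in> annulus k \<and> A \<in> \<U> k c \<and> y \<in> A \<and> lab k A = i"
    for c i k A y
  \<comment> \<open>\<open>x0\<close> only keeps the set nonempty, as \<open>infdist\<close> to the
    empty set is 0 and the bump would be constantly 1; it does not affect points with |x| >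
    4.\<close>
  define E where "E c i = insert x0 {y. \<exists>k A. P c i k A y}" for c i
  \<comment> \<open>On annulus k, |x| reaches T^2, so exponent \<delta>/2 gives a width of order
    T^\<delta>, and the constant 4 brings it below T^\<delta> / 2. Two sets of one colour this near
    to x would be closer than their gap, hence coincide.\<close>
  let ?f = "\<lambda>c i. power_bump x0 4 (\<delta>/2) (E c i)"
  have near: "\<exists>y k A. P c i k A y \<and> dist x y < T k powr \<delta> / 2 \<and> dist x x0 \<le> 2 * dist y x0 \<and> dist y x0 \<le> 2 * dist x x0"
    if x: "x \<in> X" "dist x x0 > 4" and f: "0 < ?f c i x" for x c i
  proof -
    obtain y where y: "y \<in> E c i" "dist x y < (1 - 0) * (1 + dist x x0) powr (\<delta>/2) / 4"
      by (rule power_bump_obtain[OF f]) (auto simp: E_def)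
    have "(1 + dist x x0) powr (\<delta>/2) \<le> (1 + dist x x0) powr 1"
      using x \<delta> by (intro powr_mono) auto
    then have d: "dist x y < (1 + dist x x0) / 4" using y x by simp
    then have d2: "dist x x0 \<le> 2 * dist y x0" "dist y x0 \<le> 2 * dist x x0"
      using x dist_triangle[of x x0 y] dist_triangle[of y x0 x] by (auto simp: dist_commute)
    then have "y \<noteq> x0" using x by auto
    then obtain k A where kA: "P c i k A y" using y(1) by (auto simp: E_def)
    then have k: "k0 \<le> k" and ya: "y \<in> annulus k" by (auto simp: P_def)
    have "1 * 1 \<le> T k * T k" using Tk[OF k] by (intro mult_mono) auto
    then have "1 + dist x x0 \<le> 4 * (T k * T k)" using d2 ann[OF ya] by linarith
    then have "(1 + dist x x0) powr (\<delta>/2) \<le> (4 * (T k * T k)) powr (\<delta>/2)"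
      using \<delta> by (intro powr_mono2) auto
    also have "\<dots> = 4 powr (\<delta>/2) * T k powr \<delta>"
      using Tk[OF k] by (simp add: powr_mult flip: powr_add)
    also have "\<dots> \<le> 2 * T k powr \<delta>"
      using \<delta> powr_mono[of "\<delta>/2" "1/2" 4] by (intro mult_right_mono) (auto simp: powr_half_sqrt)
    finally have "dist x y < T k powr \<delta> / 2" using y(2) by simp
    then show ?thesis using kA d2 by blast
  qed
  have same: "i = i'" if x: "x \<in> X" "dist x x0 > 4" and "c \<le> n" and f: "0 < ?f c i x" "0 < ?f c i' x" for x c i i'
  proof -
    obtain y k A where y: "P c i k A y" "dist x y < T k powr \<delta> / 2" "dist x x0 \<le> 2 * dist y x0" "dist y x0 \<le> 2 * dist x x0"
      using near[OF x f(1)] by blast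
    obtain y' k' A' where y': "P c i' k' A' y'" "dist x y' < T k' powr \<delta> / 2" "dist x x0 \<le> 2 * dist y' x0" "dist y' x0 \<le> 2 * dist x x0"
      using near[OF x f(2)] by blast
    have "k' \<le> k" "k \<le> k'"
      using y y' k0 by (auto intro!: annulus_unique[of y k y' k'] annulus_unique[of y' k' y k] simp: P_def)
    then have kk: "k = k'" by simp
    have "dist y y' < T k powr \<delta>"
      using y(2) y'(2) dist_triangle[of y y' x] by (simp add: kk dist_commute)
    then have "A = A'"
      using y(1) y'(1) kk D_disjointD[OF \<U>(1), of k c A A' y y'] \<open>c \<le> n\<close> by (force simp: P_def)
    then show ?thesis using y(1) y'(1) kk by (simp add: P_def)
  qed
  have usub: "u i (\<iota> x) \<ge> 1/2" if x: "x \<in> X" "dist x x0 > 4" and "c \<le> n" and f: "0 < ?f c i x" for x c i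
  proof -
    obtain y k A where y: "P c i k A y" "dist x y < T k powr \<delta> / 2"
      using near[OF x f] by blast
    then have k: "k0 \<le> k" and ya: "y \<in> annulus k" "y \<in> A" "A \<in> \<U> k c" "lab k A = i" by (auto simp: P_def)
    have i: "i \<in> I" "u i (\<iota> y) \<ge> 3/4" using lab[OF k \<open>c \<le> n\<close> ya(3,2,1)] ya by auto
    have "T k powr \<delta> / 2 \<le> T k powr \<delta>" by simp
    also have "T k powr \<delta> \<le> T k powr \<beta>" using Tk[OF k] \<delta> by (intro powr_mono) auto
    also have "\<dots> \<le> dist y x0 powr \<beta>" using Tk[OF k] ann[OF ya(1)] \<beta> by (intro powr_mono2) auto
    finally have "dist y x < dist y x0 powr \<beta>" using y(2) by (simp add: dist_commute)
    then have "\<bar>u i (\<iota> y) - u i (\<iota> x)\<bar> \<le> 1/4"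
      using i x ann[OF ya(1)] Tk[OF k] by (intro osc) auto
    then show ?thesis using i by linarith
  qed
  obtain G where G: "\<And>E. continuous_map H euclideanreal (G E)"
    "\<And>E x. x \<in> X \<Longrightarrow> G E (\<iota> x) = power_bump x0 4 (\<delta>/2) E x"
    by (rule power_bump_extensions[of 4 "\<delta>/2"]) (use \<delta> in auto)
  let ?Z = "H closure_of (\<iota> ` annuli q)"
  define W where "W c i = {z \<in> \<nu>. 1/2 < G (E c i) z}" for c i
  define V where "V i = (\<Union>c\<le>n. W c i) \<union> (U i - ?Z)" for i
  have Weq: "W c i = {z \<in> topspace H. 1/2 < G (E c i) z} \<inter> \<nu>" for c i
    by (auto simp: W_def \<nu>_def)
  have Wopen: "openin (corona X H \<iota>) (W c i)" for c i
    unfolding Weq corona_eq by (rule openin_subtopology_Int[OF openin_less_const(2)[OF G(1)]])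
  \<comment> \<open>Facts about far points of X pass to the corona by contradiction: a violation is
    expressed by strict inequalities, so it persists at some far point of X.\<close>
  have WU: "W c i \<subseteq> U i" if "i \<in> I" "c \<le> n" for c i
  proof
    fix z assume z: "z \<in> W c i"
    show "z \<in> U i"
    proof (rule ccontr)
      assume "z \<notin> U i"
      with z u(2) that have "u i z = 0" by (simp add: W_def)
      let ?O = "{z \<in> topspace H. 1/2 < G (E c i) z} \<inter> {z \<in> topspace H. u i z < 1/2}"
      have "openin H ?O" by (intro openin_Int openin_less_const G(1) u(1))
      moreover have "z \<in> ?O" "z \<in> \<nu>" using z \<open>u i z = 0\<close> by (auto simp: Weq)
      ultimately obtain x where x: "x \<in> X" "\<iota> x \<in> ?O" "dist x x0 > 4"
        using approx_corona'[of z ?O 4] by blast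
      then show False using usub[of x c i] that(2) G(2)[OF x(1), of "E c i"] by auto
    qed
  qed
  have Wdisj: "i = i'" if "c \<le> n" "z \<in> W c i" "z \<in> W c i'" for c i i' z
  proof -
    let ?O = "{z \<in> topspace H. 1/2 < G (E c i) z} \<inter> {z \<in> topspace H. 1/2 < G (E c i') z}"
    have "openin H ?O" by (intro openin_Int openin_less_const G(1))
    moreover have "z \<in> ?O" "z \<in> \<nu>" using that by (auto simp: Weq)
    ultimately obtain x where x: "x \<in> X" "\<iota> x \<in> ?O" "dist x x0 > 4"
      using approx_corona'[of z ?O 4] by blast
    then show ?thesis using same[of x c i i'] that(1) G(2)[OF x(1)] by auto
  qed
  have Wcov: "\<exists>c\<le>n. \<exists>i\<in>I. z \<in> W c i" if z: "z \<in> \<nu>" "z \<in> ?Z" for z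
  proof (rule ccontr)
    assume neg: "\<not> ?thesis"
    \<comment> \<open>Outside all \<open>W c i\<close> the extensions are at most 1/2; the weaker
      open condition < 1 is enough because the bump is exactly 1 on \<open>E c i\<close>.\<close>
    let ?O = "{z \<in> topspace H. \<forall>ci\<in>{..n} \<times> I. G (E (fst ci) (snd ci)) z < 1}"
    have "openin H ?O"
      using fin by (intro finite_openin_Inter openin_less_const G(1)) auto
    moreover have "z \<in> ?O" using neg z by (force simp: W_def \<nu>_def)
    moreover have "annuli q \<subseteq> X" by (auto simp: annuli_def annulus_def)
    ultimately obtain x where x: "x \<in> annuli q" "\<iota> x \<in> ?O" "dist x x0 > T k0"
      by (rule approx_corona[OF z])
    then obtain k where k: "even k = q" "x \<in> annulus k" by (auto simp: annuli_def)
    have "k0 \<le> k"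
    proof (rule ccontr)
      assume "\<not> k0 \<le> k"
      then have "T (Suc k) \<le> T k0" unfolding T_def by (intro power_increasing) auto
      then show False using ann(3)[OF k(2)] x(3) by (simp add: T2)
    qed
    moreover have "x \<in> X" using ann k by blast
    ultimately obtain c A where c: "c \<le> n" "A \<in> \<U> k c" "x \<in> A" using \<U>cov by blast
    then have "lab k A \<in> I" "x \<in> E c (lab k A)"
      using lab[OF \<open>k0 \<le> k\<close> c k(2)] k \<open>k0 \<le> k\<close> by (auto simp: E_def P_def)
    then have "G (E c (lab k A)) (\<iota> x) = 1" using G(2) \<open>x \<in> X\<close> power_bump_eq_1 by metis
    then show False using x(2) c \<open>lab k A \<in> I\<close> by force
  qed
  have UV: "V i \<subseteq> U i" if "i \<in> I" for i using WU that by (auto simp: V_def)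
  show thesis
  proof (rule that[of V])
    fix i assume i: "i \<in> I"
    have "U i \<subseteq> \<nu>" using U[OF i] openin_subset topspace_corona by blast
    then have "U i - ?Z = U i - ?Z \<inter> \<nu>" by blast
    moreover have "openin (corona X H \<iota>) (U i - ?Z \<inter> \<nu>)"
      by (intro openin_diff U[OF i]) (simp add: corona_eq Int_commute closedin_subtopology_Int_closed)
    ultimately show "openin (corona X H \<iota>) (V i)"
      unfolding V_def using Wopen by (intro openin_Un openin_Union) auto
    show "V i \<subseteq> U i" using UV i .
  next
    have "z \<in> (\<Union>i\<in>I. V i)" if "z \<in> \<nu>" for z
      using Wcov[of z] cov that by (cases "z \<in> ?Z") (auto simp: V_def)
    moreover have "(\<Union>i\<in>I. V i) \<subseteq> \<nu>" using UV cov by blast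
    ultimately show "(\<Union>i\<in>I. V i) = \<nu>" by blast
  next
    fix z assume z: "z \<in> \<nu>" "z \<in> ?Z"
    have "{i \<in> I. z \<in> V i} \<subseteq> (\<Union>c\<le>n. {i \<in> I. z \<in> W c i})" using z by (auto simp: V_def)
    then have "card {i \<in> I. z \<in> V i} \<le> card (\<Union>c\<le>n. {i \<in> I. z \<in> W c i})"
      using fin by (intro card_mono) auto
    also have "\<dots> \<le> (\<Sum>c\<le>n. card {i \<in> I. z \<in> W c i})" by (rule card_UN_le) simp
    also have "\<dots> \<le> (\<Sum>c\<le>n. 1)"
      using fin Wdisj by (intro sum_mono) (auto simp: card_le_Suc0_iff_eq)
    finally show "card {i \<in> I. z \<in> V i} \<le> Suc n" by simp
  qed
qed

theorem covering_dim_le_asdimP_le: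
  assumes "asdimP_le X n"
  shows "covering_dim_le (corona X H \<iota>) (int n)"
  unfolding covering_dim_le_def
proof (intro conjI allI impI)
  fix \<U> assume *: "finite \<U> \<and> (\<forall>U\<in>\<U>. openin (corona X H \<iota>) U) \<and> \<Union>\<U> = topspace (corona X H \<iota>)"
  obtain V where V: "\<And>U. U \<in> \<U> \<Longrightarrow> openin (corona X H \<iota>) (V U)" "\<And>U. U \<in> \<U> \<Longrightarrow> V U \<subseteq> U"
    "(\<Union>U\<in>\<U>. V U) = \<nu>"
    "\<And>z. z \<in> \<nu> \<Longrightarrow> z \<in> H closure_of (\<iota> ` annuli True) \<Longrightarrow> card {U \<in> \<U>. z \<in> V U} \<le> Suc n"
    by (rule shrink_on_annuli[OF assms, of \<U> "\<lambda>U. U" True]) (use * topspace_corona in auto)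
  obtain W where W: "\<And>U. U \<in> \<U> \<Longrightarrow> openin (corona X H \<iota>) (W U)" "\<And>U. U \<in> \<U> \<Longrightarrow> W U \<subseteq> V U"
    "(\<Union>U\<in>\<U>. W U) = \<nu>"
    "\<And>z. z \<in> \<nu> \<Longrightarrow> z \<in> H closure_of (\<iota> ` annuli False) \<Longrightarrow> card {U \<in> \<U>. z \<in> W U} \<le> Suc n"
    by (rule shrink_on_annuli[OF assms, of \<U> V False]) (use * V in auto)
  have ord: "card {A \<in> W ` \<U>. z \<in> A} \<le> Suc n" if z: "z \<in> \<nu>" for z
  proof -
    have "card {A \<in> W ` \<U>. z \<in> A} = card (W ` {U \<in> \<U>. z \<in> W U})"
      by (rule arg_cong[of _ _ card]) auto
    also have "\<dots> \<le> card {U \<in> \<U>. z \<in> W U}" using * by (intro card_image_le) simp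
    also have "\<dots> \<le> Suc n"
    proof (cases "z \<in> H closure_of (\<iota> ` annuli True)")
      case True
      \<comment> \<open>The second shrinking proceeds index by index, so it preserves the bound
        already obtained on the even annuli.\<close>
      have "card {U \<in> \<U>. z \<in> W U} \<le> card {U \<in> \<U>. z \<in> V U}"
        using * W(2) by (intro card_mono) auto
      then show ?thesis using V(4)[OF z True] by simp
    next
      case False
      then show ?thesis using W(4) z corona_subset_annuli by blast
    qed
    finally show ?thesis .
  qed
  show "\<exists>\<V>. finite \<V> \<and> (\<forall>V\<in>\<V>. openin (corona X H \<iota>) V) \<and> \<Union>\<V> = topspace (corona X H \<iota>) \<and>
      (\<forall>V\<in>\<V>. \<exists>U\<in>\<U>. V \<subseteq> U) \<and> (\<forall>x\<in>topspace (corona X H \<iota>). int (card {V \<in> \<V>. x \<in> V}) \<le> int n + 1)"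
  proof (intro exI[of _ "W ` \<U>"] conjI ballI)
    show "finite (W ` \<U>)" using * by simp
    show "\<Union> (W ` \<U>) = topspace (corona X H \<iota>)" using W(3) topspace_corona by simp
  next
    fix A assume "A \<in> W ` \<U>"
    then obtain U where "U \<in> \<U>" "A = W U" by blast
    then show "openin (corona X H \<iota>) A" "\<exists>U\<in>\<U>. A \<subseteq> U" using V(2) W(1,2) by blast+
  next
    fix z assume "z \<in> topspace (corona X H \<iota>)"
    then show "int (card {V \<in> W ` \<U>. z \<in> V}) \<le> int n + 1"
      using ord topspace_corona by fastforce
  qed
qed simp

end

subsection \<open>Lowering the number of families\<close>

lemma D_boundedI:
  assumes "0 \<le> D" "\<And>A x y. \<lbrakk>A \<in> \<V>; x \<in> A; y \<in> A\<rbrakk> \<Longrightarrow> dist x y \<le> D"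
  shows "D_bounded D \<V>"
  unfolding D_bounded_def
proof
  fix A assume A: "A \<in> \<V>"
  have "bounded A"
    unfolding bounded_two_points using assms(2)[OF A] by blast
  moreover have "diameter A \<le> D"
    unfolding diameter_def using assms A by (auto intro!: cSUP_least)
  ultimately show "bounded A \<and> diameter A \<le> D" by blast
qed

text \<open>The truncated distances \<open>\<phi> i\<close> to the complements act as coordinates in
  the nerve of the cover, and \<open>WS S\<close> corresponds to the star of the barycentre of S in
  the barycentric subdivision. Distinct S of equal size each have an index missing from the other,
  so between their sets a difference of two 1-Lipschitz coordinates changes by 2h, which forces
  distance h.\<close>

lemma families_of_bounded_multiplicity:
  fixes W :: "'i \<Rightarrow> 'a::metric_space set"
  assumes WX: "\<And>i. i \<in> I \<Longrightarrow> W i \<subseteq> X"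
    and diam: "\<And>i x y. \<lbrakk>i \<in> I; x \<in> W i; y \<in> W i\<rbrakk> \<Longrightarrow> dist x y \<le> D"
    and mult: "\<And>x. x \<in> X \<Longrightarrow> finite {i \<in> I. x \<in> W i} \<and> card {i \<in> I. x \<in> W i} \<le> m"
    and leb: "\<And>x. x \<in> X \<Longrightarrow> \<exists>i\<in>I. \<forall>y\<in>X. dist x y < \<eta> \<longrightarrow> y \<in> W i"
    and "0 < \<eta>" "0 < m" "s < \<eta> / real m" "0 \<le> D"
  shows "\<exists>\<V> :: nat \<Rightarrow> 'a set set.
    (\<forall>k<m. \<V> k \<subseteq> Pow X \<and> D_disjoint s (\<V> k) \<and> D_bounded D (\<V> k)) \<and> \<Union> (\<Union>k<m. \<V> k) = X"
proof -
  define h where "h = \<eta> / real m"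
  have h: "0 < h" "real m * h = \<eta>" using \<open>0 < \<eta>\<close> \<open>0 < m\<close> by (simp_all add: h_def)
  \<comment> \<open>The case \<open>X \<subseteq> W i\<close> is separate because
    \<open>infdist\<close> to the empty set is 0. Truncation at \<eta> = m h makes the largest
    coordinate exactly \<eta>, the top of the m intervals of length h.\<close>
  define \<phi> where "\<phi> i x = (if X \<subseteq> W i then \<eta> else min \<eta> (infdist x (X - W i)))" for i x
  have \<phi>W: "x \<in> W i" if "x \<in> X" "0 < \<phi> i x" for i x
    using that by (auto simp: \<phi>_def split: if_splits)
  have lip: "\<phi> i x \<le> \<phi> i y + dist x y" for i x y
    using infdist_triangle[of x "X - W i" y] zero_le_dist[of x y] unfolding \<phi>_def min_def by (smt (verit))
  have \<phi>max: "\<exists>i\<in>I. \<phi> i x = \<eta>" if x: "x \<in> X" for x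
  proof -
    obtain i where i: "i \<in> I" "\<forall>y\<in>X. dist x y < \<eta> \<longrightarrow> y \<in> W i" using leb x by blast
    have "\<eta> \<le> infdist x (X - W i)" if ne: "\<not> X \<subseteq> W i"
    proof (rule ccontr)
      assume "\<not> ?thesis"
      then obtain y where "y \<in> X - W i" "dist x y < \<eta>"
        using infdist_less_obtain[of x "X - W i" \<eta>] ne by (auto simp: not_le)
      then show False using i(2) by blast
    qed
    then show ?thesis using i(1) by (intro bexI[of _ i]) (auto simp: \<phi>_def)
  qed
  define WS where "WS S = {x \<in> X. \<forall>i\<in>S. 0 < \<phi> i x \<and> (\<forall>j\<in>I - S. \<phi> j x + h \<le> \<phi> i x)}" for S
  define \<V> where "\<V> k = WS ` {S. S \<subseteq> I \<and> finite S \<and> card S = Suc k}" for k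
  have cover: "\<exists>k<m. \<exists>A\<in>\<V> k. x \<in> A" if x: "x \<in> X" for x
  proof -
    define A where "A = {i \<in> I. x \<in> W i}"
    have A: "finite A" "card A \<le> m" using mult[OF x] by (auto simp: A_def)
    obtain i0 where i0: "i0 \<in> I" "\<phi> i0 x = \<eta>" using \<phi>max x by blast
    have i0A: "i0 \<in> A" using i0 \<phi>W[OF x, of i0] \<open>0 < \<eta>\<close> by (simp add: A_def)
    \<comment> \<open>At most \<open>m - 1\<close> of the values \<open>\<phi> i x\<close> lie strictly between \<open>0\<close> and \<open>\<eta>\<close>, so
      they miss one of \<open>m\<close> disjoint intervals of length \<open>h\<close>.\<close>
    have "\<exists>t<m. \<forall>i\<in>I. \<not> (real t * h < \<phi> i x \<and> \<phi> i x < real (Suc t) * h)"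
    proof (rule ccontr)
      assume "\<not> ?thesis"
      then have "\<forall>t. \<exists>i. t < m \<longrightarrow> i \<in> I \<and> real t * h < \<phi> i x \<and> \<phi> i x < real (Suc t) * h"
        by blast
      then obtain j where j: "\<And>t. t < m \<Longrightarrow> j t \<in> I \<and> real t * h < \<phi> (j t) x \<and> \<phi> (j t) x < real (Suc t) * h"
        by metis
      have "t = t'" if "t < m" "t' < m" "j t = j t'" for t t'
      proof -
        have "real t * h < real (Suc t') * h" "real t' * h < real (Suc t) * h"
          using j[OF that(1)] j[OF that(2)] that(3) by auto
        then show ?thesis using h by (simp add: mult_less_cancel_right_pos)
      qed
      then have "inj_on j {..<m}" by (auto simp: inj_on_def)
      moreover have "j ` {..<m} \<subseteq> A - {i0}"
      proof
        fix i assume "i \<in> j ` {..<m}"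
        then obtain t where t: "t < m" "i = j t" by blast
        have "real (Suc t) * h \<le> real m * h" using t h by (intro mult_right_mono) auto
        then have "i \<noteq> i0" using j[OF t(1)] t(2) i0 h by auto
        moreover have "0 \<le> real t * h" using h by simp
        then have "0 < \<phi> i x" using j[OF t(1)] unfolding t(2) by linarith
        ultimately show "i \<in> A - {i0}" using \<phi>W[OF x] j[OF t(1)] t(2) by (simp add: A_def)
      qed
      ultimately have "card {..<m} \<le> card (A - {i0})" using A by (intro card_inj_on_le) auto
      then show False using A i0A \<open>0 < m\<close> card_Diff1_less[OF A(1) i0A] by simp
    qed
    then obtain t where t: "t < m" "\<And>i. i \<in> I \<Longrightarrow> \<phi> i x \<le> real t * h \<or> real (Suc t) * h \<le> \<phi> i x"
      by (metis not_le)
    define S where "S = {i \<in> I. real (Suc t) * h \<le> \<phi> i x}"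
    have "0 < real (Suc t) * h" using h by simp
    then have pos: "0 < \<phi> i x" if "i \<in> S" for i using that by (simp add: S_def)
    have "S \<subseteq> A" using \<phi>W[OF x] pos by (auto simp: S_def A_def)
    then have S: "finite S" "card S \<le> m" using A card_mono[of A S] by (auto intro: finite_subset)
    have "real (Suc t) * h \<le> real m * h" using t h by (intro mult_right_mono) auto
    then have "i0 \<in> S" using i0 h by (simp add: S_def)
    then have "card S > 0" using S(1) card_gt_0_iff by blast
    then obtain k where k: "card S = Suc k" using gr0_implies_Suc by blast
    have "\<phi> j x + h \<le> \<phi> i x" if "i \<in> S" "j \<in> I - S" for i j
      using that t(2)[of j] h by (auto simp: S_def algebra_simps)
    then have "x \<in> WS S" using x pos by (simp add: WS_def)
    moreover have "WS S \<in> \<V> k" using S k by (auto simp: \<V>_def S_def)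
    ultimately show ?thesis using k S by (intro exI[of _ k]) auto
  qed
  have WSX: "WS S \<subseteq> X" for S by (auto simp: WS_def)
  show ?thesis
  proof (intro exI[of _ \<V>] conjI allI impI)
    fix k assume "k < m"
    show "\<V> k \<subseteq> Pow X" using WSX by (auto simp: \<V>_def)
    show "D_disjoint s (\<V> k)"
    proof (rule D_disjointI)
      show "s < h" using assms by (simp add: h_def)
      fix U V x y assume *: "U \<in> \<V> k" "V \<in> \<V> k" "U \<noteq> V" "x \<in> U" "y \<in> V"
      then obtain S S' where S: "U = WS S" "S \<subseteq> I" "finite S" "card S = Suc k"
        and S': "V = WS S'" "S' \<subseteq> I" "finite S'" "card S' = Suc k" by (auto simp: \<V>_def)
      have "S \<noteq> S'" using * S S' by blast
      then obtain i j where "i \<in> S - S'" "j \<in> S' - S"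
        using card_subset_eq[of S S'] card_subset_eq[of S' S] S S' by auto
      then have "\<phi> j x + h \<le> \<phi> i x" "\<phi> i y + h \<le> \<phi> j y"
        using * S S' by (auto simp: WS_def)
      then show "h \<le> dist x y" using lip[of i x y] lip[of j y x] by (simp add: dist_commute)
    qed
    show "D_bounded D (\<V> k)"
    proof (rule D_boundedI)
      fix A x y assume *: "A \<in> \<V> k" "x \<in> A" "y \<in> A"
      then obtain S where S: "A = WS S" "S \<subseteq> I" "finite S" "card S = Suc k" by (auto simp: \<V>_def)
      then obtain i where "i \<in> S" by fastforce
      then have "x \<in> W i" "y \<in> W i" using * S \<phi>W by (auto simp: WS_def)
      then show "dist x y \<le> D" using diam \<open>i \<in> S\<close> S by blast
    qed fact
  next
    have "\<V> k \<subseteq> Pow X" for k using WSX by (auto simp: \<V>_def)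
    then show "\<Union> (\<Union>k<m. \<V> k) = X" using cover by fast
  qed
qed

text \<open>The coarse form, with Lebesgue number \<open>\<eta>\<close>, of a property of spaces of dimension below \<open>m\<close>:
  every cover by \<open>m + 1\<close> open sets has an open shrinking without a common point.\<close>

definition coarse_shrinking ::
    "nat \<Rightarrow> real \<Rightarrow> real \<Rightarrow> 'a::metric_space set \<Rightarrow> (nat \<Rightarrow> 'a set) \<Rightarrow> (nat \<Rightarrow> 'a set) \<Rightarrow> bool" where
  "coarse_shrinking m \<epsilon> \<eta> S Q V \<longleftrightarrow>
     (\<forall>j\<le>m. \<forall>x\<in>V j. \<exists>y\<in>Q j. dist x y < \<epsilon>) \<and>
     (\<forall>x\<in>S. \<exists>j\<le>m. \<forall>y\<in>S. dist x y < \<eta> \<longrightarrow> y \<in> V j) \<and>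
     (\<forall>x\<in>S. \<exists>j\<le>m. x \<notin> V j)"

definition coarsely_shrinkable :: "nat \<Rightarrow> 'a::metric_space set \<Rightarrow> real \<Rightarrow> real \<Rightarrow> real \<Rightarrow> bool" where
  "coarsely_shrinkable m X D \<epsilon> \<eta> \<longleftrightarrow>
     (\<forall>S Q. S \<subseteq> X \<longrightarrow> (\<forall>x\<in>S. \<forall>y\<in>S. dist x y \<le> D) \<longrightarrow> S \<subseteq> (\<Union>j\<le>m. Q j) \<longrightarrow>
        (\<exists>V. coarse_shrinking m \<epsilon> \<eta> S Q V))"

lemma coarsely_shrinkable_mono:
  assumes "coarsely_shrinkable m X D \<epsilon> \<eta>" "D' \<le> D" "\<eta>' \<le> \<eta>"
  shows "coarsely_shrinkable m X D' \<epsilon> \<eta>'"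
  unfolding coarsely_shrinkable_def
proof (intro allI impI)
  fix S Q assume S: "S \<subseteq> X" "\<forall>x\<in>S. \<forall>y\<in>S. dist x y \<le> D'" "S \<subseteq> (\<Union>j\<le>m. Q j)"
  have "\<forall>x\<in>S. \<forall>y\<in>S. dist x y \<le> D" using S(2) assms(2) by force
  then obtain V where V: "coarse_shrinking m \<epsilon> \<eta> S Q V"
    using assms(1)[unfolded coarsely_shrinkable_def, rule_format, of S Q] S(1,3) by auto
  have "\<exists>j\<le>m. \<forall>y\<in>S. dist x y < \<eta>' \<longrightarrow> y \<in> V j" if x: "x \<in> S" for x
  proof -
    obtain j where "j \<le> m" "\<forall>y\<in>S. dist x y < \<eta> \<longrightarrow> y \<in> V j"
      using V x unfolding coarse_shrinking_def by blast
    then show ?thesis using assms(3) by (intro exI[of _ j]) auto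
  qed
  then show "\<exists>V. coarse_shrinking m \<epsilon> \<eta>' S Q V"
    using V unfolding coarse_shrinking_def by (intro exI[of _ V]) simp
qed

text \<open>The points \<open>P\<close> near all \<open>m + 1\<close> colours fall into pieces, each near a single set
  \<open>\<sigma> x j\<close> of every colour; a piece is bounded, so the cover can be shrunk there, and distinct
  pieces are far apart.\<close>

lemma cover_of_smaller_multiplicity:
  fixes X :: "'a::metric_space set"
  assumes \<U>X: "\<And>j. j \<le> m \<Longrightarrow> \<U> j \<subseteq> Pow X"
    and disj: "\<And>j. j \<le> m \<Longrightarrow> D_disjoint r (\<U> j)"
    and bdd: "\<And>j. j \<le> m \<Longrightarrow> D_bounded d (\<U> j)"
    and cov: "\<Union> (\<Union>j\<le>m. \<U> j) = X"
    and r: "0 < r" "0 < \<eta>" "\<eta> \<le> r / 8"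
    and shrink: "coarsely_shrinkable m X (d + r / 2) (r / 8) \<eta>"
  obtains I :: "(nat \<times> 'a set) set" and W where "\<And>i. i \<in> I \<Longrightarrow> W i \<subseteq> X"
    "\<And>i x y. \<lbrakk>i \<in> I; x \<in> W i; y \<in> W i\<rbrakk> \<Longrightarrow> dist x y \<le> d + r / 2"
    "\<And>x. x \<in> X \<Longrightarrow> finite {i \<in> I. x \<in> W i} \<and> card {i \<in> I. x \<in> W i} \<le> m"
    "\<And>x. x \<in> X \<Longrightarrow> \<exists>i\<in>I. \<forall>y\<in>X. dist x y < \<eta> / 2 \<longrightarrow> y \<in> W i"
proof -
  \<comment> \<open>Radius r/4: if two points at most r/2 apart are each within r/4 of a set of one
    colour, these sets are less than r apart, hence equal.\<close>
  define nb where "nb A = {x \<in> X. \<exists>y\<in>A. dist x y < r / 4}" for A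
  define P where "P = {x \<in> X. \<forall>j\<le>m. \<exists>U\<in>\<U> j. x \<in> nb U}"
  \<comment> \<open>The default {} beyond m lets \<open>\<sigma> x\<close> and
    \<open>\<sigma> y\<close> be compared as functions; the pieces of \<open>P\<close> are the
    fibres of \<sigma>.\<close>
  define \<sigma> where "\<sigma> x j = (if j \<le> m then SOME U. U \<in> \<U> j \<and> x \<in> nb U else {})" for x j
  have \<sigma>P: "\<sigma> x j \<in> \<U> j \<and> x \<in> nb (\<sigma> x j)" if "x \<in> P" "j \<le> m" for x j
  proof -
    have "\<exists>U. U \<in> \<U> j \<and> x \<in> nb U" using that by (auto simp: P_def)
    then have "(SOME U. U \<in> \<U> j \<and> x \<in> nb U) \<in> \<U> j \<and> x \<in> nb (SOME U. U \<in> \<U> j \<and> x \<in> nb U)"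
      by (rule someI_ex)
    then show ?thesis using that by (simp add: \<sigma>_def)
  qed
  have close: "U = U'"
    if jm: "j \<le> m" and UU: "U \<in> \<U> j" "U' \<in> \<U> j" and xy: "x \<in> nb U" "y \<in> nb U'" "dist x y \<le> r / 2" for j U U' x y
  proof (rule ccontr)
    assume "U \<noteq> U'"
    obtain a b where ab: "a \<in> U" "dist x a < r / 4" "b \<in> U'" "dist y b < r / 4"
      using xy by (auto simp: nb_def)
    have "dist a b < r"
      using ab xy(3) dist_triangle[of a b x] dist_triangle[of x b y] by (simp add: dist_commute)
    moreover have "r < dist a b" using D_disjointD[OF disj[OF jm] UU \<open>U \<noteq> U'\<close>] ab by blast
    ultimately show False by simp
  qed
  have \<sigma>close: "\<sigma> x = \<sigma> y" if "x \<in> P" "y \<in> P" "dist x y \<le> r / 2" for x y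
  proof
    fix j show "\<sigma> x j = \<sigma> y j"
    proof (cases "j \<le> m")
      case True
      then show ?thesis using close[OF True, of "\<sigma> x j" "\<sigma> y j" x y] \<sigma>P that by blast
    qed (simp add: \<sigma>_def)
  qed
  have nbdiam: "dist x y \<le> d + r / 2" if U: "j \<le> m" "U \<in> \<U> j" and xy: "x \<in> nb U" "y \<in> nb U" for j U x y
  proof -
    obtain a b where ab: "a \<in> U" "dist x a < r / 4" "b \<in> U" "dist y b < r / 4"
      using xy by (auto simp: nb_def)
    have "dist a b \<le> diameter U" and "diameter U \<le> d"
      using bdd[OF U(1)] U(2) ab unfolding D_bounded_def by (auto intro: diameter_bounded_bound)
    then show ?thesis
      using ab dist_triangle[of x y a] dist_triangle[of a y b] by (simp add: dist_commute)
  qed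
  define S where "S \<tau> = {x \<in> P. \<sigma> x = \<tau>}" for \<tau>
  define Q where "Q j = \<Union>(\<U> j)" for j
  have "\<exists>V. coarse_shrinking m (r / 8) \<eta> (S \<tau>) Q V" for \<tau>
  proof (rule shrink[unfolded coarsely_shrinkable_def, rule_format])
    show "S \<tau> \<subseteq> X" by (auto simp: S_def P_def)
    fix x y assume "x \<in> S \<tau>" "y \<in> S \<tau>"
    then have "x \<in> P" "y \<in> P" "\<sigma> x = \<sigma> y" by (auto simp: S_def)
    then show "dist x y \<le> d + r / 2" using \<sigma>P[of x 0] \<sigma>P[of y 0] nbdiam[of 0 "\<sigma> x 0" x y] by simp
  next
    show "S \<tau> \<subseteq> (\<Union>j\<le>m. Q j)" using cov by (auto simp: S_def P_def Q_def)
  qed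
  then obtain V where V: "\<And>\<tau>. coarse_shrinking m (r / 8) \<eta> (S \<tau>) Q (V \<tau>)" by metis
  \<comment> \<open>Off \<open>P\<close> some colour is already missing near the point, so full
    neighbourhoods are kept there; on \<open>P\<close> the shrinking of the piece removes a
    colour.\<close>
  define Z where "Z j = {x \<in> P. x \<in> V (\<sigma> x) j} \<union> {x \<in> X - P. x \<in> nb (Q j)}" for j
  define I where "I = {(j, U). j \<le> m \<and> U \<in> \<U> j}"
  define W where "W i = Z (fst i) \<inter> nb (snd i)" for i
  have Vnb: "\<exists>y\<in>Q j. dist x y < r / 8" if "x \<in> V \<tau> j" "j \<le> m" for x \<tau> j
    using V[of \<tau>] that unfolding coarse_shrinking_def by blast
  have Znb: "\<exists>U\<in>\<U> j. x \<in> nb U" if x: "x \<in> X" "x \<in> Z j" "j \<le> m" for x j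
  proof -
    have "\<exists>y\<in>Q j. dist x y < r / 4"
    proof (cases "x \<in> P")
      case True
      then obtain y where "y \<in> Q j" "dist x y < r / 8" using Vnb[of x "\<sigma> x" j] x by (auto simp: Z_def)
      then show ?thesis using r by (intro bexI[of _ y]) auto
    next
      case False
      then show ?thesis using x by (auto simp: Z_def nb_def)
    qed
    then show ?thesis using x(1) by (auto simp: Q_def nb_def)
  qed
  have Zmiss: "\<exists>j\<le>m. x \<notin> Z j" if x: "x \<in> X" for x
  proof (cases "x \<in> P")
    case True
    then have "x \<in> S (\<sigma> x)" by (simp add: S_def)
    then show ?thesis using V[of "\<sigma> x"] True unfolding coarse_shrinking_def Z_def by blast
  next
    case False
    then obtain j where "j \<le> m" "\<forall>U\<in>\<U> j. x \<notin> nb U" using x by (auto simp: P_def)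
    then show ?thesis using False by (auto simp: Z_def nb_def Q_def)
  qed
  \<comment> \<open>If p in \<open>P\<close> is within \<eta>/2 of x, the \<eta>-ball of p contains
    the \<eta>/2-ball of x, so the colour chosen for p serves x. Points of this ball off
    \<open>P\<close> are within \<eta> + r/8 <= r/4 of that colour.\<close>
  have Zleb: "\<exists>j\<le>m. \<forall>y\<in>X. dist x y < \<eta> / 2 \<longrightarrow> y \<in> Z j" if x: "x \<in> X" for x
  proof (cases "\<exists>p\<in>P. dist x p < \<eta> / 2")
    case True
    then obtain p where p: "p \<in> P" "dist x p < \<eta> / 2" by blast
    then have "p \<in> S (\<sigma> p)" by (simp add: S_def)
    then obtain j where j: "j \<le> m" "\<forall>y\<in>S (\<sigma> p). dist p y < \<eta> \<longrightarrow> y \<in> V (\<sigma> p) j"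
      using V[of "\<sigma> p"] unfolding coarse_shrinking_def by blast
    have "y \<in> Z j" if y: "y \<in> X" "dist x y < \<eta> / 2" for y
    proof -
      have py: "dist p y < \<eta>" using y p dist_triangle[of p y x] by (simp add: dist_commute)
      show ?thesis
      proof (cases "y \<in> P")
        case True
        then have "\<sigma> y = \<sigma> p" using \<sigma>close[OF p(1) True] py r by simp
        then show ?thesis using j(2) py True by (auto simp: S_def Z_def)
      next
        case False
        have "p \<in> V (\<sigma> p) j" using j(2) \<open>p \<in> S (\<sigma> p)\<close> r by auto
        then obtain q where "q \<in> Q j" "dist p q < r / 8" using Vnb j by blast
        then have "y \<in> nb (Q j)"
          using py r y dist_triangle[of y q p] by (auto simp: nb_def dist_commute intro!: bexI[of _ q])
        then show ?thesis using False y by (simp add: Z_def)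
      qed
    qed
    then show ?thesis using j by blast
  next
    case False
    obtain j U where j: "j \<le> m" "U \<in> \<U> j" "x \<in> U" using x cov by blast
    have "y \<in> Z j" if y: "y \<in> X" "dist x y < \<eta> / 2" for y
    proof -
      have "y \<notin> P" using False y by blast
      moreover have "y \<in> nb (Q j)"
        using y r j by (auto simp: nb_def Q_def dist_commute intro!: bexI[of _ U] bexI[of _ x])
      ultimately show ?thesis using y by (simp add: Z_def)
    qed
    then show ?thesis using j by blast
  qed
  show thesis
  proof (rule that[of I W])
    show "W i \<subseteq> X" for i by (auto simp: W_def nb_def)
    show "dist x y \<le> d + r / 2" if "i \<in> I" "x \<in> W i" "y \<in> W i" for i x y
      using that nbdiam[of "fst i" "snd i" x y] by (auto simp: W_def I_def)
  next
    fix x assume x: "x \<in> X"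
    obtain j0 where j0: "j0 \<le> m" "x \<notin> Z j0" using Zmiss x by blast
    \<comment> \<open>Neighbourhoods of distinct sets of one colour are disjoint, so the members
      containing x have distinct colours, and j0 is not among them.\<close>
    have inj: "inj_on fst {i \<in> I. x \<in> W i}"
      using close[of _ _ _ x x] r by (auto simp: inj_on_def I_def W_def)
    have img: "fst ` {i \<in> I. x \<in> W i} \<subseteq> {..m} - {j0}" using j0 by (auto simp: I_def W_def)
    have fin: "finite {i \<in> I. x \<in> W i}"
      using inj_on_finite[OF inj img] by simp
    have "card {i \<in> I. x \<in> W i} \<le> card ({..m} - {j0})"
      using card_inj_on_le[OF inj img] by simp
    then show "finite {i \<in> I. x \<in> W i} \<and> card {i \<in> I. x \<in> W i} \<le> m" using fin j0 by simp
  next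
    fix x assume x: "x \<in> X"
    obtain j where j: "j \<le> m" "\<forall>y\<in>X. dist x y < \<eta> / 2 \<longrightarrow> y \<in> Z j" using Zleb x by blast
    then have "x \<in> Z j" using x r by auto
    then obtain U where U: "U \<in> \<U> j" "x \<in> nb U" using Znb j x by blast
    have "y \<in> W (j, U)" if y: "y \<in> X" "dist x y < \<eta> / 2" for y
    proof -
      have "y \<in> Z j" using j y by blast
      then obtain U' where U': "U' \<in> \<U> j" "y \<in> nb U'" using Znb j y by blast
      have "U = U'" using close[OF j(1) U(1) U'(1) U(2) U'(2)] y r by simp
      then show ?thesis using \<open>y \<in> Z j\<close> U' by (simp add: W_def)
    qed
    then show "\<exists>i\<in>I. \<forall>y\<in>X. dist x y < \<eta> / 2 \<longrightarrow> y \<in> W i"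
      using j U by (intro bexI[of _ "(j, U)"]) (auto simp: I_def)
  qed
qed

text \<open>Dropping one family costs only a change of exponent: disjointness s is obtained from
  families of scale r, a power of a multiple of s, and the diameters, at most r^a, are again bounded
  by a power of s.\<close>

lemma asdimP_le_step:
  fixes X :: "'a::metric_space set"
  assumes asdim: "asdimP_le X (Suc n)"
    and shrink: "\<And>a. 1 \<le> a \<Longrightarrow>
      \<exists>\<beta>>0. \<exists>r1. \<forall>r>r1. coarsely_shrinkable (Suc n) X (r powr a) (r / 8) (r powr \<beta>)"
  shows "asdimP_le X n"
proof -
  obtain \<alpha> r0 where \<alpha>: "\<alpha> > 0" "r0 > 0" and fam: "\<forall>r>r0. \<exists>\<U> :: nat \<Rightarrow> 'a set set.
        (\<forall>i\<le>Suc n. \<U> i \<subseteq> Pow X \<and> D_disjoint r (\<U> i) \<and> D_bounded (r powr \<alpha>) (\<U> i)) \<and>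
        \<Union> (\<Union>i\<le>Suc n. \<U> i) = X"
    using asdim unfolding asdimP_le_def by blast
  \<comment> \<open>The added 1 lets r^a absorb the diameter bound r^\<alpha> + r/2 of the
    pieces.\<close>
  define a where "a = max \<alpha> 1 + 1"
  have a: "1 \<le> a" by (simp add: a_def)
  obtain \<beta>0 r1 where \<beta>0: "\<beta>0 > 0"
    and sh: "\<forall>r>r1. coarsely_shrinkable (Suc n) X (r powr a) (r / 8) (r powr \<beta>0)"
    using shrink[OF a] by blast
  \<comment> \<open>With exponent at most 1/2 and r > 64, r^\<beta> <= sqrt r <= r/8, as required of
    the Lebesgue number.\<close>
  define \<beta> where "\<beta> = min \<beta>0 (1/2)"
  have \<beta>: "0 < \<beta>" "\<beta> \<le> 1/2" "\<beta> \<le> \<beta>0" using \<beta>0 by (auto simp: \<beta>_def)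
  define M where "M = real (Suc n)"
  have M: "1 \<le> M" by (simp add: M_def)
  define K where "K = max r0 (max r1 64)"
  have K: "64 \<le> K" "r0 \<le> K" "r1 \<le> K" by (auto simp: K_def)
  have main: "\<exists>\<V> :: nat \<Rightarrow> 'a set set.
    (\<forall>k\<le>n. \<V> k \<subseteq> Pow X \<and> D_disjoint s (\<V> k) \<and> D_bounded (s powr (2 * a / \<beta>)) (\<V> k)) \<and>
    \<Union> (\<Union>k\<le>n. \<V> k) = X"
    if s: "s > max (4 * M) (K powr \<beta>)" for s
  proof -
    have s: "4 * M < s" "K powr \<beta> < s" using s by auto
    then have s0: "0 < s" using M by linarith
    have "1 * s \<le> 4 * M * s" using M s0 by (intro mult_right_mono) auto
    then have "K powr \<beta> < 4 * M * s" using s(2) by linarith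
    \<comment> \<open>Chosen so that the Lebesgue number r^\<beta> / 2 divided by the multiplicity M
      is 2s, which exceeds s.\<close>
    define r where "r = (4 * M * s) powr (1 / \<beta>)"
    have r\<beta>: "r powr \<beta> = 4 * M * s" using \<beta> s0 M by (simp add: r_def powr_powr)
    have "(K powr \<beta>) powr (1/\<beta>) < r"
      unfolding r_def using \<open>K powr \<beta> < 4 * M * s\<close> \<beta> by (intro powr_less_mono2) auto
    then have rK: "K < r" using \<beta> K by (simp add: powr_powr)
    then have r: "64 < r" "r0 < r" "r1 < r" using K by auto
    obtain \<U> where \<U>: "\<forall>i\<le>Suc n. \<U> i \<subseteq> Pow X \<and> D_disjoint r (\<U> i) \<and> D_bounded (r powr \<alpha>) (\<U> i)"
      "\<Union> (\<Union>i\<le>Suc n. \<U> i) = X"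
      using fam[THEN spec, THEN mp, OF r(2)] by (elim exE conjE)
    have ra: "r powr \<alpha> + r / 2 \<le> r powr a"
    proof -
      have "r powr \<alpha> \<le> r powr max \<alpha> 1"
        using r by (intro powr_mono) auto
      moreover have "r \<le> r powr max \<alpha> 1"
        using r powr_mono[of 1 "max \<alpha> 1" r] by simp
      ultimately have "r powr \<alpha> + r / 2 \<le> r powr max \<alpha> 1 + r powr max \<alpha> 1"
        using r by linarith
      also have "\<dots> \<le> r powr max \<alpha> 1 * r" using r by simp
      also have "\<dots> = r powr a" using r by (simp add: a_def powr_add)
      finally show ?thesis .
    qed
    have "r powr \<beta> \<le> r powr (1/2)" using r \<beta> by (intro powr_mono) auto
    also have "\<dots> = sqrt r" using r by (simp add: powr_half_sqrt)
    also have "\<dots> \<le> r / 8"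
    proof -
      have "sqrt r * 8 \<le> sqrt r * sqrt r"
        using r by (intro mult_left_mono real_le_rsqrt) auto
      then show ?thesis using r by simp
    qed
    finally have lam: "r powr \<beta> \<le> r / 8" .
    have "r powr \<beta> \<le> r powr \<beta>0" using r \<beta> by (intro powr_mono) auto
    then have sh': "coarsely_shrinkable (Suc n) X (r powr \<alpha> + r / 2) (r / 8) (r powr \<beta>)"
      using sh r(3) ra coarsely_shrinkable_mono by blast
    have rpos: "0 < r" "0 < r powr \<beta>" using r by auto
    have \<U>': "\<U> j \<subseteq> Pow X" "D_disjoint r (\<U> j)" "D_bounded (r powr \<alpha>) (\<U> j)" if "j \<le> Suc n" for j
      using \<U>(1) that by simp_all
    have "s < r powr \<beta> / 2 / real (Suc n)"
      using s0 M unfolding r\<beta> M_def[symmetric] by simp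
    have "\<exists>\<V> :: nat \<Rightarrow> 'a set set. (\<forall>k<Suc n. \<V> k \<subseteq> Pow X \<and> D_disjoint s (\<V> k) \<and>
        D_bounded (r powr \<alpha> + r / 2) (\<V> k)) \<and> \<Union> (\<Union>k<Suc n. \<V> k) = X"
    proof (rule cover_of_smaller_multiplicity[OF \<U>' \<U>(2) rpos lam sh'])
      fix I and W :: "nat \<times> 'a set \<Rightarrow> 'a set"
      assume IW: "\<And>i. i \<in> I \<Longrightarrow> W i \<subseteq> X"
        "\<And>i x y. \<lbrakk>i \<in> I; x \<in> W i; y \<in> W i\<rbrakk> \<Longrightarrow> dist x y \<le> r powr \<alpha> + r / 2"
        "\<And>x. x \<in> X \<Longrightarrow> finite {i \<in> I. x \<in> W i} \<and> card {i \<in> I. x \<in> W i} \<le> Suc n"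
        "\<And>x. x \<in> X \<Longrightarrow> \<exists>i\<in>I. \<forall>y\<in>X. dist x y < r powr \<beta> / 2 \<longrightarrow> y \<in> W i"
      have pos: "0 < r powr \<beta> / 2" "0 \<le> r powr \<alpha> + r / 2" using rpos by simp_all
      show "\<exists>\<V> :: nat \<Rightarrow> 'a set set. (\<forall>k<Suc n. \<V> k \<subseteq> Pow X \<and> D_disjoint s (\<V> k) \<and>
          D_bounded (r powr \<alpha> + r / 2) (\<V> k)) \<and> \<Union> (\<Union>k<Suc n. \<V> k) = X"
        by (rule families_of_bounded_multiplicity[OF IW pos(1) zero_less_Suc
          \<open>s < r powr \<beta> / 2 / real (Suc n)\<close> pos(2)])
    qed
    then obtain \<V> :: "nat \<Rightarrow> 'a set set" where \<V>: "\<forall>k<Suc n. \<V> k \<subseteq> Pow X \<and> D_disjoint s (\<V> k) \<and>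
        D_bounded (r powr \<alpha> + r / 2) (\<V> k)" "\<Union> (\<Union>k<Suc n. \<V> k) = X"
      by (elim exE conjE)
    \<comment> \<open>The factor 4M is less than s, so it costs only a doubling of the
      exponent.\<close>
    have "r powr a = (4 * M * s) powr (a / \<beta>)" by (simp add: r_def powr_powr)
    also have "\<dots> \<le> (s * s) powr (a / \<beta>)"
      using s s0 M \<beta> a by (intro powr_mono2 mult_right_mono) auto
    also have "\<dots> = s powr (2 * a / \<beta>)" using s0 by (simp add: powr_mult flip: powr_add)
    finally have "r powr \<alpha> + r / 2 \<le> s powr (2 * a / \<beta>)" using ra by simp
    then have "D_bounded (s powr (2 * a / \<beta>)) (\<V> k)" if "k \<le> n" for k
      using \<V>(1) that unfolding D_bounded_def by (meson le_imp_less_Suc order_trans)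
    moreover have "\<Union> (\<Union>k\<le>n. \<V> k) = X" using \<V>(2) by (simp add: lessThan_Suc_atMost)
    moreover have "\<V> k \<subseteq> Pow X" "D_disjoint s (\<V> k)" if "k \<le> n" for k
      using \<V>(1) that by (simp_all add: le_imp_less_Suc)
    ultimately show ?thesis by (intro exI[of _ \<V>] conjI allI impI)
  qed
  show ?thesis
    unfolding asdimP_le_def
  proof (rule exI[of _ "2 * a / \<beta>"], rule conjI, goal_cases)
    case 1
    show ?case using a \<beta> by simp
  next
    case 2
    show ?case
      by (rule exI[of _ "max (4 * M) (K powr \<beta>)"]) (use M main in simp)
  qed
qed

subsection \<open>The lower bound for the dimension of the corona\<close>

context subpower_corona
begin

text \<open>If this fails for every exponent, bad sets at rapidly growing distances from \<open>x0\<close> together define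
  one cover of a closed set \<open>Z\<close> of the corona; shrinking it there solves all but finitely many of the
  bad instances with one common exponent.\<close>

lemma shrinkable_at_own_distance:
  assumes dim: "covering_dim_le (corona X H \<iota>) (int n)" and a: "1 \<le> a"
  shows "\<exists>\<beta>>0. \<exists>r1. \<forall>r>r1. \<forall>S Q. S \<subseteq> X \<longrightarrow>
    (\<forall>x\<in>S. r powr a / 2 \<le> dist x x0 \<and> dist x x0 \<le> 4 * r powr a) \<longrightarrow> S \<subseteq> (\<Union>j\<le>Suc n. Q j) \<longrightarrow>
    (\<exists>V. coarse_shrinking (Suc n) (r / 8) (r powr \<beta>) S Q V)"
proof (rule ccontr)
  assume neg: "\<not> ?thesis"
  define bad where "bad k r S Q \<longleftrightarrow> S \<subseteq> X \<and>
    (\<forall>x\<in>S. r powr a / 2 \<le> dist x x0 \<and> dist x x0 \<le> 4 * r powr a) \<and> S \<subseteq> (\<Union>j\<le>Suc n. Q j) \<and>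
    \<not> (\<exists>V. coarse_shrinking (Suc n) (r / 8) (r powr (1 / real (Suc k))) S Q V)"
    for k :: nat and r :: real and S :: "'a set" and Q :: "nat \<Rightarrow> 'a set"
  have ex: "\<exists>r>R. \<exists>S Q. bad k r S Q" for k R
  proof (rule ccontr)
    assume "\<not> ?thesis"
    then have *: "\<forall>r>R. \<forall>S Q. \<not> bad k r S Q" by blast
    show False
      by (rule neg[THEN notE], rule exI[of _ "1 / real (Suc k)"], rule conjI, simp, rule exI[of _ R])
         (use * in \<open>simp only: bad_def de_Morgan_conj not_not, blast\<close>)
  qed
  let ?P = "\<lambda>k (t :: real \<times> 'a set \<times> (nat \<Rightarrow> 'a set)).
    bad k (fst t) (fst (snd t)) (snd (snd t)) \<and> 4 + real k < fst t"
  have ex': "\<exists>t. ?P k t \<and> 32 * r < fst t" for k r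
  proof -
    obtain r' S Q where "max (4 + real k) (32 * r) < r'" "bad k r' S Q" using ex by blast
    then show ?thesis by (intro exI[of _ "(r', S, Q)"]) simp
  qed
  \<comment> \<open>Growth by 32 keeps the shells [T/2, 4T] so far apart that only its own colours
    are visible near a bad set.\<close>
  have "\<exists>\<tau>. \<forall>k. ?P k (\<tau> k) \<and> 32 * fst (\<tau> k) < fst (\<tau> (Suc k))"
    by (rule dependent_nat_choice) (use ex' in blast)+
  then obtain \<tau> where \<tau>: "\<And>k. ?P k (\<tau> k)" "\<And>k. 32 * fst (\<tau> k) < fst (\<tau> (Suc k))" by blast
  define \<rho> where "\<rho> k = fst (\<tau> k)" for k
  define S where "S k = fst (snd (\<tau> k))" for k
  define Q where "Q k = snd (snd (\<tau> k))" for k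
  define T where "T k = \<rho> k powr a" for k
  have \<rho>: "4 + real k < \<rho> k" "32 * \<rho> k < \<rho> (Suc k)" for k
    using \<tau>[of k] by (auto simp: \<rho>_def)
  have SX: "S k \<subseteq> X" and Scov: "S k \<subseteq> (\<Union>j\<le>Suc n. Q k j)"
    and noV: "\<And>V. \<not> coarse_shrinking (Suc n) (\<rho> k / 8) (\<rho> k powr (1 / real (Suc k))) (S k) (Q k) V" for k
    using \<tau>(1)[of k] unfolding bad_def \<rho>_def S_def Q_def by blast+
  have Sloc: "T k / 2 \<le> dist x x0 \<and> dist x x0 \<le> 4 * T k" if "x \<in> S k" for x k
    using \<tau>(1)[of k] that unfolding bad_def \<rho>_def S_def T_def by blast
  have \<rho>T: "\<rho> k \<le> T k" for k
    using powr_mono[OF a, of "\<rho> k"] \<rho>(1)[of k] by (simp add: T_def)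
  have \<rho>mono: "32 * \<rho> i < \<rho> j" if "i < j" for i j
    using that
  proof (induction j)
    case (Suc j)
    show ?case
    proof (cases "i = j")
      case False
      then have "32 * \<rho> i < \<rho> j" using Suc by simp
      then show ?thesis using \<rho>(2)[of j] \<rho>(1)[of j] by linarith
    qed (use \<rho>(2) in simp)
  qed simp
  have Tmono: "32 * T i \<le> T j" if "i < j" for i j
  proof -
    have "32 * T i \<le> 32 powr a * T i"
      using powr_mono[OF a, of 32] by (intro mult_right_mono) (auto simp: T_def)
    also have "\<dots> = (32 * \<rho> i) powr a" using \<rho>(1)[of i] by (simp add: T_def powr_mult)
    also have "\<dots> \<le> T j"
      unfolding T_def using \<rho>mono[OF that] \<rho>(1)[of i] a by (intro powr_mono2) auto
    finally show ?thesis .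
  qed
  define E where "E j = insert x0 (\<Union>k. Q k j \<inter> S k)" for j
  \<comment> \<open>On the shell |x| is at most 4 \<rho>^a, so exponent 1/a gives a width of order
    \<rho>; at level 1/2 the constant 20 makes it at most 5\<rho>/40 = \<rho>/8, the tolerance of
    the shrinking.\<close>
  have near: "\<exists>y\<in>Q k j. dist x y < \<rho> k / 8"
    if x: "x \<in> S k" and f: "1/2 < power_bump x0 20 (1/a) (E j) x" for x k j
  proof -
    obtain y where y: "y \<in> E j" "dist x y < (1 - 1/2) * (1 + dist x x0) powr (1/a) / 20"
      by (rule power_bump_obtain[OF f]) (auto simp: E_def)
    have lx: "T k / 2 \<le> dist x x0" "dist x x0 \<le> 4 * T k" using Sloc[OF x] by auto
    have pos: "4 < \<rho> k" "\<rho> k \<le> T k" using \<rho>(1)[of k] \<rho>T[of k] by auto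
    have "(1 + dist x x0) powr (1/a) \<le> (5 * T k) powr (1/a)"
      using lx pos a by (intro powr_mono2) auto
    also have "\<dots> = 5 powr (1/a) * \<rho> k"
      using pos a by (simp add: T_def powr_mult powr_powr)
    also have "\<dots> \<le> 5 * \<rho> k"
      using a pos powr_mono[of "1/a" 1 5] by (intro mult_right_mono) auto
    finally have d: "dist x y < \<rho> k / 8" using y(2) by simp
    have "y \<noteq> x0" using d lx pos by auto
    then obtain l where l: "y \<in> Q l j" "y \<in> S l" using y(1) by (auto simp: E_def)
    have ly: "T l / 2 \<le> dist y x0" "dist y x0 \<le> 4 * T l" using Sloc[OF l(2)] by auto
    have tri: "dist x x0 \<le> dist x y + dist y x0" "dist y x0 \<le> dist x y + dist x x0"
      using dist_triangle[of x x0 y] dist_triangle[of y x0 x] by (auto simp: dist_commute)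
    have "\<not> l < k" using Tmono[of l k] lx ly tri d pos by auto
    moreover have "\<not> k < l" using Tmono[of k l] lx ly tri d pos by auto
    ultimately show ?thesis using l d by (intro bexI[of _ y]) auto
  qed
  obtain G where G: "\<And>E. continuous_map H euclideanreal (G E)"
    "\<And>E x. x \<in> X \<Longrightarrow> G E (\<iota> x) = power_bump x0 20 (1/a) E x"
    by (rule power_bump_extensions[of 20 "1/a"]) (use a in auto)
  define S' where "S' = (\<Union>k. S k)"
  have S'X: "S' \<subseteq> X" using SX by (auto simp: S'_def)
  let ?cl = "H closure_of (\<iota> ` S')"
  define Z where "Z = ?cl \<inter> \<nu>"
  have Z: "closedin H Z" "Z \<subseteq> \<nu>" using closed_corona by (auto simp: Z_def)
  define W where "W j = {z \<in> topspace H. 1/2 < G (E j) z} \<inter> \<nu>" for j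
  have Wopen: "openin (corona X H \<iota>) (W j)" for j
    unfolding W_def corona_eq by (rule openin_subtopology_Int[OF openin_less_const(2)[OF G(1)]])
  have WZ: "\<exists>j\<le>Suc n. z \<in> W j" if z: "z \<in> Z" for z
  proof (rule ccontr)
    assume neg: "\<not> ?thesis"
    have z': "z \<in> \<nu>" "z \<in> ?cl" using z by (auto simp: Z_def)
    let ?O = "{z \<in> topspace H. \<forall>j\<in>{..Suc n}. G (E j) z < 1}"
    have "openin H ?O"
      by (intro finite_openin_Inter openin_less_const G(1)) auto
    moreover have "z \<in> ?O" using neg z' by (force simp: W_def \<nu>_def)
    ultimately obtain x where x: "x \<in> S'" "\<iota> x \<in> ?O" "dist x x0 > 0"
      by (rule approx_corona[OF z' _ _ S'X])
    then obtain k where k: "x \<in> S k" by (auto simp: S'_def)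
    then obtain j where j: "j \<le> Suc n" "x \<in> Q k j" using Scov by blast
    then have "x \<in> E j" using k by (auto simp: E_def)
    then have "G (E j) (\<iota> x) = 1" using G(2) S'X x(1) power_bump_eq_1 by (metis subsetD)
    then show False using x(2) j(1) by force
  qed
  define \<U> where "\<U> = insert (\<nu> - Z) (W ` {..Suc n})"
  have "finite \<U>" by (simp add: \<U>_def)
  moreover have "\<forall>U\<in>\<U>. openin (corona X H \<iota>) U"
  proof -
    have "closedin (corona X H \<iota>) Z"
      unfolding corona_eq using Z closed_corona by (simp add: closedin_closed_subtopology)
    then have "openin (corona X H \<iota>) (\<nu> - Z)"
      using topspace_corona closedin_def by metis
    then show ?thesis using Wopen by (auto simp: \<U>_def)
  qed
  moreover have "\<Union>\<U> = topspace (corona X H \<iota>)"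
    using WZ unfolding topspace_corona \<U>_def by (auto simp: W_def)
  ultimately have "\<exists>\<V>. finite \<V> \<and> (\<forall>V\<in>\<V>. openin (corona X H \<iota>) V) \<and> \<Union>\<V> = topspace (corona X H \<iota>) \<and>
      (\<forall>V\<in>\<V>. \<exists>U\<in>\<U>. V \<subseteq> U) \<and> (\<forall>x\<in>topspace (corona X H \<iota>). int (card {V \<in> \<V>. x \<in> V}) \<le> int n + 1)"
    using dim[unfolded covering_dim_le_def, THEN conjunct2, THEN spec, of \<U>] by simp
  then obtain \<V> where \<V>: "finite \<V>" "\<forall>V\<in>\<V>. openin (corona X H \<iota>) V" "\<Union>\<V> = \<nu>"
    "\<forall>V\<in>\<V>. \<exists>U\<in>\<U>. V \<subseteq> U" "\<forall>z\<in>\<nu>. int (card {V \<in> \<V>. z \<in> V}) \<le> int n + 1"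
    unfolding topspace_corona by (elim exE conjE)
  \<comment> \<open>Each member of the refinement is assigned to one colour containing it, and
    \<open>Suc (Suc n)\<close> marks those inside no \<open>W j\<close>. A common point of the n + 2
    unions \<open>g j\<close> would lie in n + 2 different members.\<close>
  define pick where "pick V = (if \<exists>j\<le>Suc n. V \<subseteq> W j then SOME j. j \<le> Suc n \<and> V \<subseteq> W j else Suc (Suc n))" for V
  have pick: "V \<subseteq> W (pick V)" if "pick V \<le> Suc n" for V
  proof -
    have "\<exists>j\<le>Suc n. V \<subseteq> W j" using that by (auto simp: pick_def split: if_splits)
    then show ?thesis unfolding pick_def using someI_ex[of "\<lambda>j. j \<le> Suc n \<and> V \<subseteq> W j"] by simp
  qed
  have pick_le: "pick V \<le> Suc n" if "\<exists>j\<le>Suc n. V \<subseteq> W j" for V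
    unfolding pick_def using that someI_ex[of "\<lambda>j. j \<le> Suc n \<and> V \<subseteq> W j"] by simp
  define g where "g j = \<Union>{V \<in> \<V>. pick V = j}" for j
  have gopen: "openin (corona X H \<iota>) (g j)" for j
    unfolding g_def using \<V>(2) by (intro openin_Union) auto
  have gW: "g j \<subseteq> W j" if "j \<le> Suc n" for j using pick that by (auto simp: g_def)
  have gZ: "Z \<subseteq> (\<Union>j\<in>{..Suc n}. g j)"
  proof
    fix z assume z: "z \<in> Z"
    then obtain V where V: "V \<in> \<V>" "z \<in> V" using \<V>(3) Z by blast
    then obtain U where U: "U \<in> \<U>" "V \<subseteq> U" using \<V>(4) by blast
    then have "\<exists>j\<le>Suc n. V \<subseteq> W j" using V z by (auto simp: \<U>_def)
    then have "pick V \<le> Suc n" by (rule pick_le)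
    then show "z \<in> (\<Union>j\<in>{..Suc n}. g j)" using V by (auto simp: g_def)
  qed
  have gmiss: "\<exists>j\<le>Suc n. z \<notin> g j" if z: "z \<in> \<nu>" for z
  proof (rule ccontr)
    assume "\<not> ?thesis"
    then have "\<forall>j. \<exists>V. j \<le> Suc n \<longrightarrow> V \<in> \<V> \<and> z \<in> V \<and> pick V = j" by (auto simp: g_def)
    then obtain v where v: "\<And>j. j \<le> Suc n \<Longrightarrow> v j \<in> \<V> \<and> z \<in> v j \<and> pick (v j) = j" by metis
    have "inj_on v {..Suc n}" by (rule inj_on_inverseI[of _ pick]) (use v in auto)
    moreover have "v ` {..Suc n} \<subseteq> {V \<in> \<V>. z \<in> V}" using v by auto
    ultimately have "card {..Suc n} \<le> card {V \<in> \<V>. z \<in> V}"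
      using \<V>(1) by (intro card_inj_on_le) auto
    then show False using \<V>(5) z by fastforce
  qed
  obtain u :: "nat \<Rightarrow> 'b \<Rightarrow> real" where u: "\<And>j. continuous_map H euclideanreal (u j)"
    "\<And>j z. j \<in> {..Suc n} \<Longrightarrow> z \<in> \<nu> \<Longrightarrow> z \<notin> g j \<Longrightarrow> u j z = 0" "\<And>z. z \<in> Z \<Longrightarrow> \<exists>j\<in>{..Suc n}. u j z > 1"
    by (rule subordinate_functions[OF finite_atMost Z gopen gZ]) blast+
  obtain \<beta> R where \<beta>: "0 < \<beta>" "\<beta> \<le> 1" "1 \<le> R" and
    osc: "\<And>i x y. \<lbrakk>i \<in> {..Suc n}; x \<in> X; y \<in> X; R < dist x x0; dist x y < dist x x0 powr \<beta>\<rbrakk>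
      \<Longrightarrow> \<bar>u i (\<iota> x) - u i (\<iota> y)\<bar> \<le> 1/2"
    by (rule uniform_family[where u = u and e = "1/2" and I = "{..Suc n}"]) (use u(1) in auto)
  \<comment> \<open>On the corona some \<open>u j\<close> exceeds 1 at each point of
    \<open>Z\<close>, no point has all \<open>u j\<close> at least 1/2, and \<open>u j\<close> at
    least 1/2 forces the bump of colour j above 1/2. \<open>R1\<close>, \<open>R2\<close>,
    \<open>R3\<close> are radii beyond which this holds on X, for the first fact on the bad sets;
    these yield the three clauses of \<open>coarse_shrinking\<close>.\<close>
  obtain R1 where R1: "\<And>x. x \<in> X \<Longrightarrow> \<iota> x \<in> ?cl \<inter> {z \<in> topspace H. \<forall>j\<in>{..Suc n}. u j z \<le> 1} \<Longrightarrow> dist x x0 \<le> R1"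
  proof (rule far_from_corona)
    show "closedin H (?cl \<inter> {z \<in> topspace H. \<forall>j\<in>{..Suc n}. u j z \<le> 1})"
      using u(1) by (intro closedin_Int finite_closedin_Inter closedin_le_const) auto
    show "?cl \<inter> {z \<in> topspace H. \<forall>j\<in>{..Suc n}. u j z \<le> 1} \<inter> \<nu> = {}"
    proof (rule equals0I)
      fix z assume z: "z \<in> ?cl \<inter> {z \<in> topspace H. \<forall>j\<in>{..Suc n}. u j z \<le> 1} \<inter> \<nu>"
      then obtain j where "j \<in> {..Suc n}" "1 < u j z" using u(3)[of z] unfolding Z_def by blast
      then show False using z by (simp flip: not_le)
    qed
  qed blast
  obtain R2 where R2: "\<And>x. x \<in> X \<Longrightarrow> \<iota> x \<in> {z \<in> topspace H. \<forall>j\<in>{..Suc n}. 1/2 \<le> u j z} \<Longrightarrow> dist x x0 \<le> R2"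
  proof (rule far_from_corona)
    show "closedin H {z \<in> topspace H. \<forall>j\<in>{..Suc n}. 1/2 \<le> u j z}"
      using u(1) by (intro finite_closedin_Inter closedin_le_const) auto
    show "{z \<in> topspace H. \<forall>j\<in>{..Suc n}. 1/2 \<le> u j z} \<inter> \<nu> = {}"
    proof (rule equals0I)
      fix z assume z: "z \<in> {z \<in> topspace H. \<forall>j\<in>{..Suc n}. 1/2 \<le> u j z} \<inter> \<nu>"
      then obtain j where "j \<le> Suc n" "z \<notin> g j" using gmiss[of z] by blast
      then have "u j z = 0" using u(2)[of j z] z by simp
      moreover have "1/2 \<le> u j z" using z \<open>j \<le> Suc n\<close> by blast
      ultimately show False by simp
    qed
  qed blast
  define C where "C j = {z \<in> topspace H. 1/2 \<le> u j z} \<inter> {z \<in> topspace H. G (E j) z \<le> 1/2}" for j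
  obtain R3 where R3: "\<And>x. x \<in> X \<Longrightarrow> \<iota> x \<in> (\<Union>j\<in>{..Suc n}. C j) \<Longrightarrow> dist x x0 \<le> R3"
  proof (rule far_from_corona)
    have "closedin H (C j)" for j
      unfolding C_def by (intro closedin_Int closedin_le_const u(1) G(1))
    then show "closedin H (\<Union>j\<in>{..Suc n}. C j)" by (intro closedin_Union) auto
    have "z \<notin> C j" if "z \<in> \<nu>" "j \<le> Suc n" for z j
      using u(2)[of j z] gW[of j] that by (cases "z \<in> g j") (auto simp: C_def W_def)
    then show "(\<Union>j\<in>{..Suc n}. C j) \<inter> \<nu> = {}" by auto
  qed blast
  \<comment> \<open>The factors 2 come from |x| >= \<rho>/2 on \<open>S k\<close>; the bound
    \<open>2 / \<beta>\<close> makes 1/(k+1), the exponent at which instance k is bad, at most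
    \<beta>/2.\<close>
  obtain k :: nat where "max (max (2 * R) (2 * R1)) (max (max (2 * R2) (2 * R3)) (2 / \<beta>)) < real k"
    using reals_Archimedean2 by blast
  then have k: "2 * R < real k" "2 * R1 < real k" "2 * R2 < real k" "2 * R3 < real k" "2 / \<beta> < real k"
    by simp_all
  have far: "R < dist x x0" "R1 < dist x x0" "R2 < dist x x0" "R3 < dist x x0" "\<rho> k / 2 \<le> dist x x0"
    if "x \<in> S k" for x
    using Sloc[OF that] \<rho>T[of k] \<rho>(1)[of k] k by linarith+
  have kb: "1 / real (Suc k) \<le> \<beta> / 2" using k \<beta> by (simp add: field_simps)
  have \<rho>4: "4 < \<rho> k" using \<rho>(1)[of k] by simp
  \<comment> \<open>Half of \<beta> pays for the passage from \<rho> to |x|, which is at least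
    \<rho>/2 and hence at least sqrt \<rho>.\<close>
  have scale: "\<rho> k powr (1 / real (Suc k)) \<le> dist x x0 powr \<beta>" if "x \<in> S k" for x
  proof -
    have "sqrt (\<rho> k) * 2 \<le> sqrt (\<rho> k) * sqrt (\<rho> k)"
      using \<rho>4 by (intro mult_left_mono real_le_rsqrt) auto
    then have "sqrt (\<rho> k) \<le> \<rho> k / 2" using \<rho>4 by simp
    then have s: "\<rho> k powr (1/2) \<le> dist x x0" using far(5)[OF that] \<rho>4 by (simp add: powr_half_sqrt)
    have "\<rho> k powr (1 / real (Suc k)) \<le> \<rho> k powr (\<beta> / 2)"
      using kb \<rho>4 by (intro powr_mono) auto
    also have "\<dots> = (\<rho> k powr (1/2)) powr \<beta>" by (simp add: powr_powr)
    also have "\<dots> \<le> dist x x0 powr \<beta>" using s \<beta> by (intro powr_mono2) auto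
    finally show ?thesis .
  qed
  define V where "V j = {x \<in> S k. 1/2 \<le> u j (\<iota> x)}" for j
  have "coarse_shrinking (Suc n) (\<rho> k / 8) (\<rho> k powr (1 / real (Suc k))) (S k) (Q k) V"
    unfolding coarse_shrinking_def
  proof (intro conjI allI impI ballI)
    fix j x assume j: "j \<le> Suc n" and "x \<in> V j"
    then have x: "x \<in> S k" "1/2 \<le> u j (\<iota> x)" "x \<in> X" using SX by (auto simp: V_def)
    have "\<iota> x \<notin> (\<Union>j\<in>{..Suc n}. C j)" using R3[OF x(3)] far(4)[OF x(1)] by linarith
    then have "\<iota> x \<notin> C j" using j by blast
    then have "\<not> G (E j) (\<iota> x) \<le> 1/2"
      using x(2) iota_in[OF x(3)] by (simp add: C_def)
    then show "\<exists>y\<in>Q k j. dist x y < \<rho> k / 8" using near[OF x(1), of j] G(2)[OF x(3)] by simp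
  next
    fix x assume x: "x \<in> S k"
    then have xX: "x \<in> X" "x \<in> S'" using SX by (auto simp: S'_def)
    have "\<iota> x \<in> ?cl" using xX iota_in S'X by (auto intro: subsetD[OF closure_of_subset_Int])
    then have "\<not> (\<forall>j\<in>{..Suc n}. u j (\<iota> x) \<le> 1)"
      using R1[OF xX(1), OF IntI] far(2)[OF x] iota_in[OF xX(1)] by auto
    then obtain j where j: "j \<le> Suc n" "1 < u j (\<iota> x)" by (auto simp: not_le)
    have "y \<in> V j" if y: "y \<in> S k" "dist x y < \<rho> k powr (1 / real (Suc k))" for y
    proof -
      have "\<bar>u j (\<iota> x) - u j (\<iota> y)\<bar> \<le> 1/2"
        using j xX y far(1)[OF x] scale[OF x] SX by (intro osc) auto
      then have "1/2 \<le> u j (\<iota> y)" using j(2) by linarith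
      then show ?thesis using y(1) by (simp add: V_def)
    qed
    then show "\<exists>j\<le>Suc n. \<forall>y\<in>S k. dist x y < \<rho> k powr (1 / real (Suc k)) \<longrightarrow> y \<in> V j" using j(1) by blast
  next
    fix x assume x: "x \<in> S k"
    then have xX: "x \<in> X" using SX by auto
    have "\<not> (\<forall>j\<in>{..Suc n}. 1/2 \<le> u j (\<iota> x))"
      using R2[OF xX] far(3)[OF x] iota_in[OF xX] by auto
    then show "\<exists>j\<le>Suc n. x \<notin> V j" by (auto simp: V_def)
  qed
  then show False by (rule notE[OF noV])
qed

end

section \<open>Moving bounded pieces to a prescribed distance from the basepoint\<close>

lemma exists_point_at_distance:
  fixes X :: "'a::metric_space set"
  assumes "\<not> bounded X" "M_connected M X" "x0 \<in> X" "0 \<le> t" "0 \<le> M"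
  obtains z where "z \<in> X" "t \<le> dist z x0" "dist z x0 \<le> t + M"
proof -
  obtain w where w: "w \<in> X" "t \<le> dist w x0"
    using assms(1) unfolding bounded_def by (metis dist_commute linear)
  then obtain k z where z: "z 0 = x0" "z k = w" "\<forall>i\<le>k. z i \<in> X" "\<forall>i<k. dist (z i) (z (Suc i)) \<le> M"
    using assms(2,3) unfolding M_connected_def by blast
  \<comment> \<open>The first point of the chain at distance at least t overshoots by at most one
    step M.\<close>
  define i where "i = (LEAST i. t \<le> dist (z i) x0)"
  have i: "t \<le> dist (z i) x0" "i \<le> k"
    unfolding i_def using w z(2) by (auto intro: LeastI[of _ k] Least_le)
  have "dist (z i) x0 \<le> t + M"
  proof (cases i)
    case (Suc j)
    have "dist (z j) x0 < t" using not_less_Least[of j "\<lambda>i. t \<le> dist (z i) x0"] Suc by (simp add: i_def)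
    moreover have "dist (z j) (z i) \<le> M" using z(4) i(2) Suc by simp
    ultimately show ?thesis using dist_triangle[of "z i" x0 "z j"] by (simp add: dist_commute)
  qed (use z assms in simp)
  then show ?thesis using that z(3) i by blast
qed

text \<open>The shrinking is pulled back along \<open>g\<close>. The colours are cut down to
  \<open>S\<close> before being transported because \<open>g\<close> is controlled only on
  \<open>S\<close>.\<close>

lemma coarse_shrinking_isometry:
  assumes g: "\<And>x y. x \<in> S \<Longrightarrow> y \<in> S \<Longrightarrow> dist (g x) (g y) = dist x y"
    and V: "coarse_shrinking m \<epsilon> \<eta> (g ` S) (\<lambda>j. g ` (Q j \<inter> S)) V"
  shows "coarse_shrinking m \<epsilon> \<eta> S Q (\<lambda>j. {x \<in> S. g x \<in> V j})"
  unfolding coarse_shrinking_def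
proof (intro conjI allI impI ballI)
  fix j x assume "j \<le> m" "x \<in> {x \<in> S. g x \<in> V j}"
  then obtain y where "y \<in> Q j \<inter> S" "dist (g x) (g y) < \<epsilon>" "x \<in> S"
    using V unfolding coarse_shrinking_def by blast
  then show "\<exists>y\<in>Q j. dist x y < \<epsilon>" using g by auto
next
  fix x assume x: "x \<in> S"
  then obtain j where "j \<le> m" "\<forall>y\<in>g ` S. dist (g x) y < \<eta> \<longrightarrow> y \<in> V j"
    using V unfolding coarse_shrinking_def by blast
  then show "\<exists>j\<le>m. \<forall>y\<in>S. dist x y < \<eta> \<longrightarrow> y \<in> {x \<in> S. g x \<in> V j}"
    using g x by (intro exI[of _ j]) auto
next
  fix x assume "x \<in> S"
  then show "\<exists>j\<le>m. x \<notin> {x \<in> S. g x \<in> V j}"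
    using V unfolding coarse_shrinking_def by blast
qed

text \<open>If s lies in f(K) and z in h(K), then h after the inverse of f takes s into h(K), whose
  diameter is that of K.\<close>

lemma cocompact_translation:
  assumes "cocompact_space X"
  obtains D where "0 \<le> D" "\<And>s z. s \<in> X \<Longrightarrow> z \<in> X \<Longrightarrow>
    \<exists>g. g ` X \<subseteq> X \<and> (\<forall>x\<in>X. \<forall>y\<in>X. dist (g x) (g y) = dist x y) \<and> dist (g s) z \<le> D"
proof -
  obtain K where K: "K \<subseteq> X" "compact K" "X = (\<Union>f\<in>isometries X. f ` K)"
    using assms unfolding cocompact_space_def by blast
  have bK: "bounded K" using K(2) by (rule compact_imp_bounded)
  have "\<exists>g. g ` X \<subseteq> X \<and> (\<forall>x\<in>X. \<forall>y\<in>X. dist (g x) (g y) = dist x y) \<and> dist (g s) z \<le> diameter K"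
    if s: "s \<in> X" and z: "z \<in> X" for s z
  proof -
    obtain f p where f: "f \<in> isometries X" "p \<in> K" "s = f p" using K(3) s by blast
    obtain h q where h: "h \<in> isometries X" "q \<in> K" "z = h q" using K(3) z by blast
    have fX: "f ` X = X" and fd: "\<And>x y. x \<in> X \<Longrightarrow> y \<in> X \<Longrightarrow> dist (f x) (f y) = dist x y"
      using f(1) by (auto simp: isometries_def)
    have hX: "h ` X = X" and hd: "\<And>x y. x \<in> X \<Longrightarrow> y \<in> X \<Longrightarrow> dist (h x) (h y) = dist x y"
      using h(1) by (auto simp: isometries_def)
    define e where "e = inv_into X f"
    have e: "e x \<in> X" "f (e x) = x" if "x \<in> X" for x
      using that fX by (auto simp: e_def inv_into_into f_inv_into_f)
    have ed: "dist (e x) (e y) = dist x y" if "x \<in> X" "y \<in> X" for x y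
      using fd[of "e x" "e y"] e that by simp
    have pX: "p \<in> X" "q \<in> X" using f h K(1) by auto
    have "dist (e s) p = 0" using fd[of "e s" p] e[OF s] pX f(3) by simp
    then have "dist (h (e s)) z = dist p q" using hd pX h(3) by simp
    also have "\<dots> \<le> diameter K" using diameter_bounded_bound[OF bK f(2) h(2)] .
    finally show ?thesis
      using e ed hd hX by (intro exI[of _ "h \<circ> e"]) auto
  qed
  then show ?thesis using that diameter_ge_0[OF bK] by blast
qed

context subpower_corona
begin

lemma coarsely_shrinkable_of_dim:
  assumes dim: "covering_dim_le (corona X H \<iota>) (int n)" and a: "1 \<le> a"
    and X: "\<not> bounded X" "cocompact_space X" "0 < M" "M_connected M X"
  shows "\<exists>\<beta>>0. \<exists>r1. \<forall>r>r1. coarsely_shrinkable (Suc n) X (r powr a) (r / 8) (r powr \<beta>)"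
proof -
  obtain \<beta> r1 where \<beta>: "0 < \<beta>" and own: "\<forall>r>r1. \<forall>S Q. S \<subseteq> X \<longrightarrow>
    (\<forall>x\<in>S. r powr a / 2 \<le> dist x x0 \<and> dist x x0 \<le> 4 * r powr a) \<longrightarrow> S \<subseteq> (\<Union>j\<le>Suc n. Q j) \<longrightarrow>
    (\<exists>V. coarse_shrinking (Suc n) (r / 8) (r powr \<beta>) S Q V)"
    using shrinkable_at_own_distance[OF dim a] by blast
  obtain D where D: "0 \<le> D" and trans: "\<And>s z. s \<in> X \<Longrightarrow> z \<in> X \<Longrightarrow>
    \<exists>g. g ` X \<subseteq> X \<and> (\<forall>x\<in>X. \<forall>y\<in>X. dist (g x) (g y) = dist x y) \<and> dist (g s) z \<le> D"
    by (rule cocompact_translation[OF X(2)]) blast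
  have "coarsely_shrinkable (Suc n) X (r powr a) (r / 8) (r powr \<beta>)"
    if r: "max r1 (max 1 (2 * (D + M))) < r" for r
    unfolding coarsely_shrinkable_def
  proof (intro allI impI)
    fix S Q assume S: "S \<subseteq> X" "\<forall>x\<in>S. \<forall>y\<in>S. dist x y \<le> r powr a" "S \<subseteq> (\<Union>j\<le>Suc n. Q j)"
    show "\<exists>V. coarse_shrinking (Suc n) (r / 8) (r powr \<beta>) S Q V"
    proof (cases "S = {}")
      case True
      then show ?thesis by (intro exI[of _ "\<lambda>_. {}"]) (simp add: coarse_shrinking_def)
    next
      case False
      then obtain s where s: "s \<in> S" "s \<in> X" using S(1) by blast
      have T: "2 * (D + M) < r powr a"
        using r a powr_mono[OF a, of r] by simp
      \<comment> \<open>The image of \<open>S\<close>, of diameter at most r^a and with a point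
        within D of z, lies at distances between r^a - D and 3 r^a + D + M; as 2(D + M) < r^a, this
        is inside the required shell.\<close>
      obtain z where z: "z \<in> X" "2 * r powr a \<le> dist z x0" "dist z x0 \<le> 2 * r powr a + M"
        by (rule exists_point_at_distance[OF X(1,4) x0, of "2 * r powr a"]) (use X in auto)
      obtain g where g: "g ` X \<subseteq> X" "\<forall>x\<in>X. \<forall>y\<in>X. dist (g x) (g y) = dist x y" "dist (g s) z \<le> D"
        using trans[OF s(2) z(1)] by blast
      have gd: "dist (g x) (g y) = dist x y" if "x \<in> S" "y \<in> S" for x y
        using g(2) S(1) that by blast
      have loc: "r powr a / 2 \<le> dist (g x) x0 \<and> dist (g x) x0 \<le> 4 * r powr a" if x: "x \<in> S" for x
      proof -
        have "dist (g x) z \<le> r powr a + D"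
          using gd[OF x s(1)] S(2) x s(1) g(3) dist_triangle[of "g x" z "g s"] by fastforce
        then show ?thesis
          using z T X(3) D dist_triangle[of "g x" x0 z] dist_triangle[of z x0 "g x"] by (simp add: dist_commute)
      qed
      have "r1 < r" using r by simp
      moreover have "g ` S \<subseteq> X" using g(1) S(1) by blast
      moreover have "\<forall>x\<in>g ` S. r powr a / 2 \<le> dist x x0 \<and> dist x x0 \<le> 4 * r powr a" using loc by blast
      moreover have "g ` S \<subseteq> (\<Union>j\<le>Suc n. g ` (Q j \<inter> S))" using S(3) by blast
      ultimately obtain V where "coarse_shrinking (Suc n) (r / 8) (r powr \<beta>) (g ` S) (\<lambda>j. g ` (Q j \<inter> S)) V"
        using own[THEN spec, THEN mp, THEN spec, THEN spec, THEN mp, THEN mp, THEN mp, of r "g ` S" "\<lambda>j. g ` (Q j \<inter> S)"]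
        by blast
      then have "coarse_shrinking (Suc n) (r / 8) (r powr \<beta>) S Q (\<lambda>j. {x \<in> S. g x \<in> V j})"
        by (rule coarse_shrinking_isometry[rotated]) (rule gd)
      then show ?thesis by blast
    qed
  qed
  then show ?thesis using \<beta> by blast
qed

lemma corona_nonempty:
  assumes "\<not> bounded X"
  shows "\<nu> \<noteq> {}"
proof
  assume "\<nu> = {}"
  then obtain R where R: "\<And>x. x \<in> X \<Longrightarrow> \<iota> x \<in> topspace H \<Longrightarrow> dist x x0 \<le> R"
    using far_from_corona[of "topspace H"] by auto
  then have "bounded X" unfolding bounded_def using iota_in by (metis dist_commute)
  then show False using assms by blast
qed

end

section \<open>Comparison of the two dimensions\<close>

lemma covering_dim_le_mono:
  assumes "covering_dim_le T m" "m \<le> n"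
  shows "covering_dim_le T n"
  unfolding covering_dim_le_def
proof (intro conjI allI impI)
  show "-1 \<le> n" using assms by (simp add: covering_dim_le_def)
  fix \<U> assume "finite \<U> \<and> (\<forall>U\<in>\<U>. openin T U) \<and> \<Union>\<U> = topspace T"
  from assms(1)[unfolded covering_dim_le_def, THEN conjunct2, THEN spec, THEN mp, OF this]
  obtain \<V> where \<V>: "finite \<V>" "\<forall>V\<in>\<V>. openin T V" "\<Union>\<V> = topspace T" "\<forall>V\<in>\<V>. \<exists>U\<in>\<U>. V \<subseteq> U"
    "\<forall>x\<in>topspace T. int (card {V \<in> \<V>. x \<in> V}) \<le> m + 1"
    by (elim exE conjE)
  from \<V>(5) have "\<forall>x\<in>topspace T. int (card {V \<in> \<V>. x \<in> V}) \<le> n + 1"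
    using assms(2) by force
  with \<V> show "\<exists>\<V>. finite \<V> \<and> (\<forall>V\<in>\<V>. openin T V) \<and> \<Union>\<V> = topspace T \<and>
      (\<forall>V\<in>\<V>. \<exists>U\<in>\<U>. V \<subseteq> U) \<and> (\<forall>x\<in>topspace T. int (card {V \<in> \<V>. x \<in> V}) \<le> n + 1)"
    by (intro exI[of _ \<V>] conjI)
qed

lemma covering_dim_le_imp_nonneg:
  assumes "covering_dim_le T n" "topspace T \<noteq> {}"
  shows "0 \<le> n"
proof -
  obtain x where x: "x \<in> topspace T" using assms(2) by blast
  have "finite {topspace T} \<and> (\<forall>U\<in>{topspace T}. openin T U) \<and> \<Union>{topspace T} = topspace T" by simp
  from assms(1)[unfolded covering_dim_le_def, THEN conjunct2, THEN spec, THEN mp, OF this]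
  obtain \<V> where \<V>: "finite \<V>" "\<Union>\<V> = topspace T" "\<forall>x\<in>topspace T. int (card {V \<in> \<V>. x \<in> V}) \<le> n + 1"
    by (elim exE conjE)
  obtain V where "V \<in> \<V>" "x \<in> V" using \<V>(2) x by blast
  then have "card {V \<in> \<V>. x \<in> V} > 0" using \<V>(1) by (auto simp: card_gt_0_iff)
  then show ?thesis using \<V>(3) x by force
qed

theorem corollary2p11:
  fixes X :: "'a::metric_space set" and x0 :: 'a and M :: real
    and H :: "'b topology" and \<iota> :: "'a \<Rightarrow> 'b"
  assumes "proper_space X"
    and "\<not> bounded X"
    and "cocompact_space X"
    and "M > 0" and "M_connected M X"
    and "asdimP X < \<infinity>"
    and "x0 \<in> X"
    and "subpower_compactification X x0 H \<iota>"
  shows "asdimP X = covering_dim (corona X H \<iota>)"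
proof -
  interpret subpower_corona X x0 H \<iota>
    using assms by unfold_locales
  have "\<exists>n. asdimP_le X n"
  proof (rule ccontr)
    assume "\<not> ?thesis"
    then have "asdimP X = Inf {}" unfolding asdimP_def by simp
    then show False using assms(6) by (simp add: top_ereal_def)
  qed
  define m where "m = (LEAST n. asdimP_le X n)"
  have m: "asdimP_le X m" unfolding m_def using \<open>\<exists>n. asdimP_le X n\<close> by (rule LeastI_ex)
  have m_le: "m \<le> n" if "asdimP_le X n" for n unfolding m_def using that by (rule Least_le)
  have dim_ge: "int m \<le> n" if n: "covering_dim_le (corona X H \<iota>) n" for n
  proof (rule ccontr)
    assume less: "\<not> int m \<le> n"
    have "0 \<le> n"
      using covering_dim_le_imp_nonneg[OF n] corona_nonempty[OF assms(2)] topspace_corona by simp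
    then obtain k where k: "m = Suc k" "n \<le> int k"
      using less by (cases m) auto
    then have "covering_dim_le (corona X H \<iota>) (int k)" using covering_dim_le_mono n by blast
    then have "\<exists>\<beta>>0. \<exists>r1. \<forall>r>r1. coarsely_shrinkable (Suc k) X (r powr a) (r / 8) (r powr \<beta>)"
      if "1 \<le> a" for a
      using coarsely_shrinkable_of_dim[OF _ that assms(2-5)] by blast
    then have "asdimP_le X k"
      using m k(1) asdimP_le_step by blast
    then show False using m_le k by fastforce
  qed
  have "asdimP X = ereal (real m)"
    unfolding asdimP_def
  proof (rule antisym)
    show "Inf {ereal (real n) |n. asdimP_le X n} \<le> ereal (real m)"
      using m by (intro Inf_lower CollectI exI[of _ m]) simp
    show "ereal (real m) \<le> Inf {ereal (real n) |n. asdimP_le X n}"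
    proof (rule Inf_greatest)
      fix t assume "t \<in> {ereal (real n) |n. asdimP_le X n}"
      then obtain n where "t = ereal (real n)" "asdimP_le X n" by blast
      then show "ereal (real m) \<le> t" using m_le by simp
    qed
  qed
  moreover have "covering_dim (corona X H \<iota>) = ereal (real m)"
    unfolding covering_dim_def
  proof (rule antisym)
    have "covering_dim_le (corona X H \<iota>) (int m)" using covering_dim_le_asdimP_le m .
    then show "Inf {ereal (real_of_int n) |n. covering_dim_le (corona X H \<iota>) n} \<le> ereal (real m)"
      by (intro Inf_lower CollectI exI[of _ "int m"]) simp
    show "ereal (real m) \<le> Inf {ereal (real_of_int n) |n. covering_dim_le (corona X H \<iota>) n}"
    proof (rule Inf_greatest)
      fix t assume "t \<in> {ereal (real_of_int n) |n. covering_dim_le (corona X H \<iota>) n}"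
      then obtain n where "t = ereal (real_of_int n)" "covering_dim_le (corona X H \<iota>) n" by blast
      moreover from this(2) have "real m \<le> real_of_int n" using dim_ge by force
      ultimately show "ereal (real m) \<le> t" by simp
    qed
  qed
  ultimately show ?thesis by simp
qed

end
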